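(* Let $\widetilde{\mathcal H}_{\mathrm{CF}}$ and $\mathcal H_{\mathrm{CFc}}$ both denote, as commutative algebras, the free commutative algebra $S(V_{\mathrm{CF}})$ on the vector space $V_{\mathrm{CF}}$ spanned by connected oriented cycle-free Feynman graphs (product = disjoint union, unit $\mathbf 1$ = empty graph), equipped respectively with the coproducts $$\Delta(\Gamma)=\sum_{\gamma\text{ poset-compatible covering subgraph of }\Gamma}\gamma\otimes\Gamma/\gamma,\qquad \Delta_c(\Gamma)=\sum_{V_1\sqcup V_2=\mathcal V(\Gamma),\ V_2<V_1}\Gamma(V_1)\otimes\Gamma(V_2)$$ for every oriented cycle-free Feynman graph $\Gamma$ (extended as algebra morphisms). Let $\Phi:\mathcal H_{\mathrm{CFc}}\to\widetilde{\mathcal H}_{\mathrm{CF}}\otimes\mathcal H_{\mathrm{CFc}}$ be the linear map given by the formula of $\Delta$. Then $$(\mathrm{Id}_{\widetilde{\mathcal H}_{\mathrm{CF}}}\otimes\Delta_c)\circ\Phi=m^{1,3}\circ(\Phi\otimes\Phi)\circ\Delta_c,$$ where $m^{1,3}:\widetilde{\mathcal H}_{\mathrm{CF}}\otimes\mathcal H_{\mathrm{CFc}}\otimes\widetilde{\mathcal H}_{\mathrm{CF}}\otimes\mathcal H_{\mathrm{CFc}}\to\widetilde{\mathcal H}_{\mathrm{CF}}\otimes\mathcal H_{\mathrm{CFc}}\otimes\mathcal H_{\mathrm{CFc}}$ is $a\otimes b\otimes c\otimes d\mapsto ac\otimes b\otimes d$. In other words, $\mathcal H_{\mathrm{CFc}}$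 is a $\widetilde{\mathcal H}_{\mathrm{CF}}$-comodule coalgebra.
   Context: An oriented Feynman graph is an oriented (non-planar) graph with finitely many vertices and edges (possibly of several types), edges being internal (both ends at vertices) or external (one open end). A cycle is a finite sequence of internal edges $(e_1,\ldots,e_n)$ with the target of $e_k$ equal to the source of $e_{k+1}$ for all $k$ modulo $n$; cycle-free means no cycle. For a cycle-free graph $\Gamma$, the vertex set $\mathcal V(\Gamma)$ is a poset with $v<w$ iff there is a directed path from $v$ to $w$. For $P\subseteq\mathcal V(\Gamma)$ nonempty, $\Gamma(P)$ is the graph whose internal edges are the internal edges of $\Gamma$ with both ends in $P$ and whose external edges are the external edges of $\Gamma$ attached to $P$ together with the internal edges of $\Gamma$ with exactly one end in $P$; $\Gamma(\emptyset)=\mathbf 1$. A covering subgraph $\gamma$ of $\Gamma$ corresponds to a partition $\mathcal V(\Gamma)=P_1\sqcup\cdots\sqcup P_n$ with each $\Gamma(P_j)$ connected, and $\gamma$ is identified with the product $\Gamma(P_1)\cdots\Gamma(P_n)$ in $S(V_{\mathrm{CF}})$. The contracted graph $\Gamma/\gamma$ is obtained by shrinking each $\Gamma(P_j)$ to a single vertex (internal edges of $\Gamma$ between different blocks remain, with induced orientation; external edges of $\Gamma$ remain). The covering subgraph $\gamma$ is poset-compatible if $\Gamma/\gamma$ is cycle-free. For disjoint $V_1,V_2$ with $V_1\sqcup V_2=\mathcal V(\Gamma)$, the notation $V_2<V_1$ means that for any comparable $v_1\in V_1$, $v_2\in V_2$ one has $v_2<v_1$ (such a pair is called an admissible cut).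 *)

theory Defs
  imports "HOL-Library.Poly_Mapping" "HOL-Library.Multiset" "HOL-Library.Disjoint_Sets"
begin

section \<open>Oriented Feynman graphs\<close>

text \<open>
  Vertices have type \<open>'v\<close>, edges type \<open>'e\<close>, and each edge carries one of the (arbitrarily many)
  edge types in \<open>'t\<close>.  The value \<open>None\<close> of \<open>src\<close> or \<open>tgt\<close> is an open end, so external edges
  are oriented as well (incoming or outgoing).  Parallel edges are allowed.
\<close>

record ('v, 'e, 't) fgraph =
  verts :: "'v set"
  edges :: "'e set"
  src :: "'e \<Rightarrow> 'v option"
  tgt :: "'e \<Rightarrow> 'v option"
  etype :: "'e \<Rightarrow> 't"

definition feynman :: "('v, 'e, 't) fgraph \<Rightarrow> bool" where
  "feynman G \<longleftrightarrow> finite (verts G) \<and> finite (edges G) \<and>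
     (\<forall>e\<in>edges G. set_option (src G e) \<subseteq> verts G \<and> set_option (tgt G e) \<subseteq> verts G \<and>
        \<not> (src G e = None \<and> tgt G e = None))"

definition internal_edges :: "('v, 'e, 't) fgraph \<Rightarrow> 'e set" where
  "internal_edges G = {e \<in> edges G. src G e \<noteq> None \<and> tgt G e \<noteq> None}"

definition is_cycle :: "('v, 'e, 't) fgraph \<Rightarrow> 'e list \<Rightarrow> bool" where
  "is_cycle G es \<longleftrightarrow> es \<noteq> [] \<and> set es \<subseteq> internal_edges G \<and>
     (\<forall>k<length es. tgt G (es ! k) = src G (es ! ((k + 1) mod length es)))"

definition cycle_free :: "('v, 'e, 't) fgraph \<Rightarrow> bool" where
  "cycle_free G \<longleftrightarrow> (\<nexists>es. is_cycle G es)"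

definition arcs :: "('v, 'e, 't) fgraph \<Rightarrow> ('v \<times> 'v) set" where
  "arcs G = {(v, w). \<exists>e\<in>internal_edges G. src G e = Some v \<and> tgt G e = Some w}"

definition vless :: "('v, 'e, 't) fgraph \<Rightarrow> 'v \<Rightarrow> 'v \<Rightarrow> bool" where
  "vless G v w \<longleftrightarrow> (v, w) \<in> (arcs G)\<^sup>+"

definition linked :: "('v, 'e, 't) fgraph \<Rightarrow> ('v \<times> 'v) set" where
  "linked G = {(v, w). v \<in> verts G \<and> w \<in> verts G \<and> (v, w) \<in> (arcs G \<union> (arcs G)\<inverse>)\<^sup>*}"

text \<open>The empty graph is not connected.\<close>

definition gconnected :: "('v, 'e, 't) fgraph \<Rightarrow> bool" where
  "gconnected G \<longleftrightarrow> verts G \<noteq> {} \<and> linked G = verts G \<times> verts G"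

definition components :: "('v, 'e, 't) fgraph \<Rightarrow> 'v set set" where
  "components G = verts G // linked G"

text \<open>
  The graph \<open>\<Gamma>(P)\<close>, for \<open>P\<close> a set of vertices: edges with no end in \<open>P\<close> are dropped, and an end
  outside \<open>P\<close> becomes open, so an internal edge with exactly one end in \<open>P\<close> becomes external.
\<close>

definition restrict_end :: "'v set \<Rightarrow> 'v option \<Rightarrow> 'v option" where
  "restrict_end P x = (case x of None \<Rightarrow> None | Some v \<Rightarrow> if v \<in> P then Some v else None)"

definition subgraph :: "('v, 'e, 't) fgraph \<Rightarrow> 'v set \<Rightarrow> ('v, 'e, 't) fgraph" where
  "subgraph G P =
     \<lparr>verts = P,
      edges = {e \<in> edges G. restrict_end P (src G e) \<noteq> None \<or> restrict_end P (tgt G e) \<noteq> None},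
      src = (\<lambda>e. restrict_end P (src G e)),
      tgt = (\<lambda>e. restrict_end P (tgt G e)),
      etype = etype G\<rparr>"

text \<open>
  A covering subgraph is represented by its partition of the vertex set; the vertices of the
  contracted graph are the blocks.
\<close>

definition covering :: "('v, 'e, 't) fgraph \<Rightarrow> 'v set set \<Rightarrow> bool" where
  "covering G \<pi> \<longleftrightarrow> partition_on (verts G) \<pi> \<and> (\<forall>P\<in>\<pi>. gconnected (subgraph G P))"

definition block :: "'v set set \<Rightarrow> 'v \<Rightarrow> 'v set" where
  "block \<pi> v = (THE P. P \<in> \<pi> \<and> v \<in> P)"

definition contract :: "('v, 'e, 't) fgraph \<Rightarrow> 'v set set \<Rightarrow> ('v set, 'e, 't) fgraph" where
  "contract G \<pi> =
     \<lparr>verts = \<pi>,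
      edges = edges G - (\<Union>P\<in>\<pi>. internal_edges (subgraph G P)),
      src = (\<lambda>e. map_option (block \<pi>) (src G e)),
      tgt = (\<lambda>e. map_option (block \<pi>) (tgt G e)),
      etype = etype G\<rparr>"

definition poset_compatible :: "('v, 'e, 't) fgraph \<Rightarrow> 'v set set \<Rightarrow> bool" where
  "poset_compatible G \<pi> \<longleftrightarrow> covering G \<pi> \<and> cycle_free (contract G \<pi>)"

definition admissible_cut :: "('v, 'e, 't) fgraph \<Rightarrow> 'v set \<Rightarrow> 'v set \<Rightarrow> bool" where
  "admissible_cut G V1 V2 \<longleftrightarrow> V1 \<inter> V2 = {} \<and> V1 \<union> V2 = verts G \<and>
     (\<forall>v1\<in>V1. \<forall>v2\<in>V2. vless G v1 v2 \<or> vless G v2 v1 \<longrightarrow> vless G v2 v1)"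


section \<open>Isomorphism classes\<close>

definition fgraph_iso :: "('v, 'e, 't) fgraph \<Rightarrow> ('w, 'f, 't) fgraph \<Rightarrow> bool" where
  "fgraph_iso G H \<longleftrightarrow> (\<exists>f g. bij_betw f (verts G) (verts H) \<and> bij_betw g (edges G) (edges H) \<and>
     (\<forall>e\<in>edges G. src H (g e) = map_option f (src G e) \<and> tgt H (g e) = map_option f (tgt G e) \<and>
        etype H (g e) = etype G e))"

text \<open>
  Every (finite) Feynman graph is isomorphic to one whose vertices and edges are natural numbers,
  so the class of a graph over any vertex and edge types is recorded by its models over \<open>nat\<close>.
\<close>

definition iso_class :: "('v, 'e, 't) fgraph \<Rightarrow> (nat, nat, 't) fgraph set" where
  "iso_class G = {H. feynman H \<and> fgraph_iso G H}"

typedef 't ccf_graph =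
  "{iso_class G | G :: (nat, nat, 't) fgraph. feynman G \<and> cycle_free G \<and> gconnected G}"
proof -
  let ?G = "\<lparr>verts = {0}, edges = {}, src = \<lambda>_. None, tgt = \<lambda>_. None, etype = \<lambda>_. undefined\<rparr>
    :: (nat, nat, 't) fgraph"
  have "feynman ?G" "cycle_free ?G" "gconnected ?G"
    by (auto simp: feynman_def cycle_free_def is_cycle_def internal_edges_def gconnected_def linked_def)
  then show ?thesis by blast
qed

text \<open>Meaningful for connected cycle-free Feynman graphs only.\<close>

definition ccf :: "('v, 'e, 't) fgraph \<Rightarrow> 't ccf_graph" where
  "ccf G = Abs_ccf_graph (iso_class G)"


section \<open>Free modules and their tensor products\<close>

text \<open>
  The free \<open>'k\<close>-module on the basis \<open>'a\<close> is \<open>'a \<Rightarrow>\<^sub>0 'k\<close>.  The tensor product of the modules with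
  bases \<open>'a\<close> and \<open>'b\<close> is the module with basis \<open>'a \<times> 'b\<close>.
\<close>

definition lin_ext :: "('a \<Rightarrow> 'b \<Rightarrow>\<^sub>0 'k) \<Rightarrow> ('a \<Rightarrow>\<^sub>0 'k) \<Rightarrow> ('b \<Rightarrow>\<^sub>0 'k::field)" where
  "lin_ext f x = (\<Sum>a\<in>Poly_Mapping.keys x.
     Poly_Mapping.map (\<lambda>c. Poly_Mapping.lookup x a * c) (f a))"

definition tensor :: "('a \<Rightarrow>\<^sub>0 'k) \<Rightarrow> ('b \<Rightarrow>\<^sub>0 'k) \<Rightarrow> ('a \<times> 'b \<Rightarrow>\<^sub>0 'k::field)"
    (infixr \<open>\<otimes>\<close> 75) where
  "x \<otimes> y = (\<Sum>a\<in>Poly_Mapping.keys x. \<Sum>b\<in>Poly_Mapping.keys y.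
     Poly_Mapping.single (a, b) (Poly_Mapping.lookup x a * Poly_Mapping.lookup y b))"

abbreviation basis :: "'a \<Rightarrow> 'a \<Rightarrow>\<^sub>0 'k::field" where
  "basis a \<equiv> Poly_Mapping.single a 1"

definition tensor_map ::
  "(('a \<Rightarrow>\<^sub>0 'k) \<Rightarrow> ('c \<Rightarrow>\<^sub>0 'k)) \<Rightarrow> (('b \<Rightarrow>\<^sub>0 'k) \<Rightarrow> ('d \<Rightarrow>\<^sub>0 'k)) \<Rightarrow>
     ('a \<times> 'b \<Rightarrow>\<^sub>0 'k) \<Rightarrow> ('c \<times> 'd \<Rightarrow>\<^sub>0 'k::field)" where
  "tensor_map f g = lin_ext (\<lambda>(a, b). f (basis a) \<otimes> g (basis b))"


section \<open>The algebra of cycle-free graphs and its two coproducts\<close>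

text \<open>
  The free commutative algebra on the vector space with basis the classes of connected cycle-free
  graphs: the polynomial algebra in these classes.  Monomials are multisets, and the
  multiplication of \<open>\<Rightarrow>\<^sub>0\<close> is the convolution product induced by the sum of multisets.
\<close>

type_synonym ('t, 'k) H = "'t ccf_graph multiset \<Rightarrow>\<^sub>0 'k"

type_synonym ('t, 'k) HH = "('t ccf_graph multiset \<times> 't ccf_graph multiset) \<Rightarrow>\<^sub>0 'k"

text \<open>A graph is the product of its connected components.\<close>

definition graph_monomial :: "('v, 'e, 't) fgraph \<Rightarrow> 't ccf_graph multiset" where
  "graph_monomial G = image_mset (\<lambda>P. ccf (subgraph G P)) (mset_set (components G))"

definition graph_elt :: "('v, 'e, 't) fgraph \<Rightarrow> ('t, 'k::field) H" where
  "graph_elt G = basis (graph_monomial G)"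

definition graph_of :: "'t ccf_graph multiset \<Rightarrow> (nat, nat, 't) fgraph" where
  "graph_of M = (SOME G. feynman G \<and> cycle_free G \<and> graph_monomial G = M)"

definition Delta_formula :: "('v, 'e, 't) fgraph \<Rightarrow> ('t, 'k::field) HH" where
  "Delta_formula G = (\<Sum>\<pi> | poset_compatible G \<pi>.
     (\<Prod>P\<in>\<pi>. graph_elt (subgraph G P)) \<otimes> graph_elt (contract G \<pi>))"

definition Delta_c_formula :: "('v, 'e, 't) fgraph \<Rightarrow> ('t, 'k::field) HH" where
  "Delta_c_formula G = (\<Sum>(V1, V2)\<in>{(V1, V2). admissible_cut G V1 V2}.
     graph_elt (subgraph G V1) \<otimes> graph_elt (subgraph G V2))"

text \<open>
  The monomials are exactly the isomorphism classes of all cycle-free graphs, so a linear map is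
  determined by its values on graphs, connected or not.  As the formulas are invariant under
  isomorphism and turn disjoint unions into products, these linear maps are the algebra morphisms
  determined by the values of the formulas on connected graphs.
\<close>

definition Delta :: "('t, 'k::field) H \<Rightarrow> ('t, 'k) HH" where
  "Delta = lin_ext (\<lambda>M. Delta_formula (graph_of M))"

definition Delta_c :: "('t, 'k::field) H \<Rightarrow> ('t, 'k) HH" where
  "Delta_c = lin_ext (\<lambda>M. Delta_c_formula (graph_of M))"

text \<open>The map \<open>Delta\<close> regarded as a coaction on the coalgebra with coproduct \<open>Delta_c\<close>.\<close>

definition Phi :: "('t, 'k::field) H \<Rightarrow> ('t, 'k) HH" where
  "Phi = Delta"

text \<open>\<open>a \<otimes> b \<otimes> c \<otimes> d \<mapsto> a c \<otimes> b \<otimes> d\<close>, with its source bracketed as \<open>(a \<otimes> b) \<otimes> (c \<otimes> d)\<close>.\<close>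

definition m13 ::
  "((('a::monoid_add \<times> 'b) \<times> ('a \<times> 'd)) \<Rightarrow>\<^sub>0 'k) \<Rightarrow> (('a \<times> 'b \<times> 'd) \<Rightarrow>\<^sub>0 'k::field)" where
  "m13 = lin_ext (\<lambda>((a, b), (c, d)). (basis a * basis c) \<otimes> basis b \<otimes> basis d)"

end

theory Submission
  imports Defs
begin

text \<open>
  A linear map is determined by its values on graphs, so both sides are evaluated on a cycle-free
  graph \<open>G\<close>.  The left side becomes a sum over pairs of a poset-compatible partition \<open>\<pi>\<close> and an
  admissible cut \<open>(W1, W2)\<close> of \<open>G/\<pi>\<close>, the right side a sum over admissible cuts \<open>(V1, V2)\<close> of \<open>G\<close>
  with poset-compatible partitions \<open>\<pi>1\<close> of \<open>G(V1)\<close> and \<open>\<pi>2\<close> of \<open>G(V2)\<close>.  As \<open>G\<close> has no cycles, an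
  admissible cut is a splitting of the vertices with no edge from \<open>V1\<close> to \<open>V2\<close>; hence
  \<open>(\<pi>, W1, W2) \<mapsto> (\<Union>W1, \<Union>W2, W1, W2)\<close> is a bijection between the two index sets, with inverse
  given by \<open>\<pi> = \<pi>1 \<union> \<pi>2\<close>.  Corresponding terms agree because \<open>(G/\<pi>)(W)\<close> and \<open>G(\<Union>W)/W\<close> are
  isomorphic.  The maps are defined through a chosen graph for each monomial, so one also needs that
  the monomial of a cycle-free graph determines its isomorphism class and that every monomial occurs.
\<close>

section \<open>Linear extension and tensor product\<close>

lemma lookup_lin_ext:
  "Poly_Mapping.lookup (lin_ext f x) b =
     (\<Sum>a\<in>Poly_Mapping.keys x. Poly_Mapping.lookup x a * Poly_Mapping.lookup (f a) b)"
  by (auto simp: lin_ext_def lookup_sum map.rep_eq when_def intro!: sum.cong)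

text \<open>Coefficients vanish outside the support, so any larger finite index set gives the same
  sum. This lets several elements with different supports be expanded over one common set.\<close>

lemma lookup_lin_ext_superset:
  assumes "finite A" "Poly_Mapping.keys x \<subseteq> A"
  shows "Poly_Mapping.lookup (lin_ext f x) b =
     (\<Sum>a\<in>A. Poly_Mapping.lookup x a * Poly_Mapping.lookup (f a) b)"
  unfolding lookup_lin_ext using assms
  by (intro sum.mono_neutral_left) (auto simp: in_keys_iff)

lemma lin_ext_basis [simp]: "lin_ext f (basis a) = f a"
  by (rule poly_mapping_eqI) (simp add: lookup_lin_ext)

lemma lin_ext_zero [simp]: "lin_ext f 0 = 0"
  by (simp add: lin_ext_def)

lemma lin_ext_add: "lin_ext f (x + y) = lin_ext f x + lin_ext f y"
proof (rule poly_mapping_eqI)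
  fix b
  let ?A = "Poly_Mapping.keys x \<union> Poly_Mapping.keys y"
  have "Poly_Mapping.keys (x + y) \<subseteq> ?A" by (rule Poly_Mapping.keys_add)
  then show "Poly_Mapping.lookup (lin_ext f (x + y)) b = Poly_Mapping.lookup (lin_ext f x + lin_ext f y) b"
    by (simp add: lookup_lin_ext_superset[of ?A] lookup_add algebra_simps sum.distrib)
qed

lemma lin_ext_sum: "lin_ext f (sum g A) = (\<Sum>i\<in>A. lin_ext f (g i))"
  by (induction A rule: infinite_finite_induct) (auto simp: lin_ext_add)

text \<open>A composite of linear extensions is again determined by its values on the basis: after
  expanding both over finite sets, the two sums are interchanged.\<close>

lemma lin_ext_lin_ext: "lin_ext g (lin_ext f x) = lin_ext (\<lambda>a. lin_ext g (f a)) x"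
proof (rule poly_mapping_eqI)
  fix c
  let ?K = "Poly_Mapping.keys x"
  \<comment> \<open>Cancellation can make the support of \<open>lin_ext f x\<close> strictly smaller
    than \<open>?B\<close>; only the inclusion is needed for the expansion.\<close>
  let ?B = "\<Union>a\<in>?K. Poly_Mapping.keys (f a)"
  have sub: "Poly_Mapping.keys (lin_ext f x) \<subseteq> ?B"
  proof
    fix b assume "b \<in> Poly_Mapping.keys (lin_ext f x)"
    then have "(\<Sum>a\<in>?K. Poly_Mapping.lookup x a * Poly_Mapping.lookup (f a) b) \<noteq> 0"
      by (simp add: in_keys_iff lookup_lin_ext)
    then obtain a where "a \<in> ?K" "Poly_Mapping.lookup x a * Poly_Mapping.lookup (f a) b \<noteq> 0"
      by (meson sum.neutral)
    then show "b \<in> ?B" by (auto simp: in_keys_iff)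
  qed
  have "Poly_Mapping.lookup (lin_ext g (lin_ext f x)) c =
      (\<Sum>b\<in>?B. \<Sum>a\<in>?K. Poly_Mapping.lookup x a * Poly_Mapping.lookup (f a) b * Poly_Mapping.lookup (g b) c)"
    using sub by (simp add: lookup_lin_ext_superset[of ?B] lookup_lin_ext[of f] sum_distrib_right)
  also have "\<dots> = (\<Sum>a\<in>?K. Poly_Mapping.lookup x a *
      (\<Sum>b\<in>?B. Poly_Mapping.lookup (f a) b * Poly_Mapping.lookup (g b) c))"
    by (subst sum.swap) (simp add: sum_distrib_left mult.assoc)
  also have "\<dots> = (\<Sum>a\<in>?K. Poly_Mapping.lookup x a * Poly_Mapping.lookup (lin_ext g (f a)) c)"
    by (intro sum.cong refl arg_cong[where f = "\<lambda>z. _ * z"] lookup_lin_ext_superset[symmetric]) auto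
  finally show "Poly_Mapping.lookup (lin_ext g (lin_ext f x)) c =
      Poly_Mapping.lookup (lin_ext (\<lambda>a. lin_ext g (f a)) x) c"
    by (simp add: lookup_lin_ext)
qed

text \<open>This holds off the supports too, where both sides are zero, so bilinearity of the tensor
  product can be checked coefficient by coefficient.\<close>

lemma lookup_tensor:
  "Poly_Mapping.lookup (x \<otimes> y) (a, b) = Poly_Mapping.lookup x a * Poly_Mapping.lookup y b"
proof -
  have "Poly_Mapping.lookup (x \<otimes> y) (a, b) =
    (\<Sum>a'\<in>Poly_Mapping.keys x. \<Sum>b'\<in>Poly_Mapping.keys y.
      if a' = a then if b' = b then Poly_Mapping.lookup x a' * Poly_Mapping.lookup y b' else 0 else 0)"
    by (auto simp: tensor_def lookup_sum lookup_single when_def intro!: sum.cong)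
  also have "\<dots> = (\<Sum>a'\<in>Poly_Mapping.keys x.
      if a' = a then \<Sum>b'\<in>Poly_Mapping.keys y.
        if b' = b then Poly_Mapping.lookup x a' * Poly_Mapping.lookup y b' else 0 else 0)"
    by (intro sum.cong) auto
  also have "\<dots> = Poly_Mapping.lookup x a * Poly_Mapping.lookup y b"
    by (simp add: sum.delta in_keys_iff)
  finally show ?thesis .
qed

lemma tensor_basis: "basis a \<otimes> basis b = basis (a, b)"
  by (simp add: tensor_def)

lemma tensor_sum_left: "sum f A \<otimes> y = (\<Sum>i\<in>A. f i \<otimes> y)"
  by (rule poly_mapping_eqI) (auto simp: lookup_tensor lookup_sum sum_distrib_right split_paired_all)

lemma tensor_sum_right: "x \<otimes> sum f A = (\<Sum>i\<in>A. x \<otimes> f i)"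
  by (rule poly_mapping_eqI) (auto simp: lookup_tensor lookup_sum sum_distrib_left split_paired_all)

lemma prod_basis: "(\<Prod>i\<in>A. basis (m i)) = basis (\<Sum>i\<in>A. m i)"
  by (induction A rule: infinite_finite_induct) (auto simp: mult_single)

section \<open>Paths and cycles\<close>

lemma arcsI:
  "e \<in> edges G \<Longrightarrow> src G e = Some v \<Longrightarrow> tgt G e = Some w \<Longrightarrow> (v, w) \<in> arcs G"
  by (auto simp: arcs_def internal_edges_def)

lemma arcsE:
  assumes "(v, w) \<in> arcs G"
  obtains e where "e \<in> edges G" "src G e = Some v" "tgt G e = Some w"
  using assms by (auto simp: arcs_def internal_edges_def)

lemma feynmanD:
  assumes "feynman G"
  shows "finite (verts G)" "finite (edges G)"
    "\<And>e v. e \<in> edges G \<Longrightarrow> src G e = Some v \<Longrightarrow> v \<in> verts G"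
    "\<And>e v. e \<in> edges G \<Longrightarrow> tgt G e = Some v \<Longrightarrow> v \<in> verts G"
    "\<And>e. e \<in> edges G \<Longrightarrow> src G e \<noteq> None \<or> tgt G e \<noteq> None"
  using assms by (auto simp: feynman_def)

lemma arcs_in_verts: "feynman G \<Longrightarrow> (v, w) \<in> arcs G \<Longrightarrow> v \<in> verts G \<and> w \<in> verts G"
  by (meson arcsE feynmanD)

text \<open>Choosing an edge for every arc turns a closed walk into a cycle of edges, and the
  sources of the edges of a cycle form a closed walk. Afterwards only the relation
  \<open>arcs\<close> matters, and cycles of edges need not be handled again.\<close>

lemma cycle_free_iff_acyclic: "cycle_free G \<longleftrightarrow> acyclic (arcs G)"
proof
  assume cf: "cycle_free G"
  show "acyclic (arcs G)"
  proof (rule acyclicI, rule allI, rule notI)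
    fix v assume "(v, v) \<in> (arcs G)\<^sup>+"
    then obtain n where n: "n > 0" "(v, v) \<in> arcs G ^^ n" by (auto simp: trancl_power)
    then obtain p where p: "p 0 = v" "p n = v" "\<forall>i<n. (p i, p (Suc i)) \<in> arcs G"
      by (auto simp: relpow_fun_conv)
    then have "\<forall>i. \<exists>e. i < n \<longrightarrow> e \<in> edges G \<and> src G e = Some (p i) \<and> tgt G e = Some (p (Suc i))"
      by (meson arcsE)
    then obtain e where e: "\<And>i. i < n \<Longrightarrow>
        e i \<in> edges G \<and> src G (e i) = Some (p i) \<and> tgt G (e i) = Some (p (Suc i))"
      by metis
    \<comment> \<open>At the last index the successor wraps around to \<open>0\<close>, which is
      consistent because \<open>p n = p 0\<close>.\<close>
    have "tgt G (map e [0..<n] ! k) = src G (map e [0..<n] ! ((k + 1) mod n))" if "k < n" for k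
    proof (cases "Suc k = n")
      case True
      then show ?thesis using e[of k] e[of 0] n p that by simp
    next
      case False
      then show ?thesis using e[of k] e[of "Suc k"] that by simp
    qed
    then have "is_cycle G (map e [0..<n])"
      using e n by (auto simp: is_cycle_def internal_edges_def)
    then show False using cf by (auto simp: cycle_free_def)
  qed
next
  assume ac: "acyclic (arcs G)"
  show "cycle_free G"
    unfolding cycle_free_def
  proof
    assume "\<exists>es. is_cycle G es"
    then obtain es where es: "is_cycle G es" ..
    let ?n = "length es"
    \<comment> \<open>The sources are read off periodically, giving an infinite walk that returns to
      its start after \<open>?n\<close> steps.\<close>
    define s where "s k = the (src G (es ! (k mod ?n)))" for k
    have n: "?n > 0" using es by (auto simp: is_cycle_def)
    have step: "(s k, s (Suc k)) \<in> arcs G" for k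
    proof -
      let ?e = "es ! (k mod ?n)"
      have k: "k mod ?n < ?n" using n by simp
      then have "?e \<in> internal_edges G" using es by (force simp: is_cycle_def)
      moreover have "tgt G ?e = src G (es ! (Suc k mod ?n))"
        using es k by (simp add: is_cycle_def mod_Suc_eq)
      ultimately show ?thesis
        by (auto simp: s_def arcs_def intro!: bexI[of _ ?e]) (auto simp: internal_edges_def)
    qed
    have "(s 0, s (Suc k)) \<in> (arcs G)\<^sup>+" for k
      by (induction k) (use step in \<open>auto intro: trancl_into_trancl\<close>)
    from this[of "?n - 1"] have "(s 0, s 0) \<in> (arcs G)\<^sup>+"
      using n by (simp add: s_def)
    then show False using ac by (auto simp: acyclic_def)
  qed
qed

text \<open>Without steps from \<open>A\<close> to \<open>B\<close>, a walk starting in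
  \<open>A\<close> stays in \<open>A\<close>, and a walk ending in \<open>B\<close> lies entirely in
  \<open>B\<close>. A closed walk is therefore confined to one part, where acyclicity is
  assumed.\<close>

lemma acyclic_two_parts:
  assumes R: "R \<subseteq> (A \<union> B) \<times> (A \<union> B)" and no: "\<And>x y. (x, y) \<in> R \<Longrightarrow> x \<in> A \<Longrightarrow> y \<in> B \<Longrightarrow> False"
    and "acyclic (R \<inter> A \<times> A)" "acyclic (R \<inter> B \<times> B)"
  shows "acyclic R"
proof (rule acyclicI, rule allI, rule notI)
  fix x assume x: "(x, x) \<in> R\<^sup>+"
  have fwd: "y \<in> A \<and> (x, y) \<in> (R \<inter> A \<times> A)\<^sup>+" if "(x, y) \<in> R\<^sup>+" "x \<in> A" for y
    using that
  proof (induction rule: trancl_induct)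
    case (base y)
    then show ?case using R no by (auto intro!: r_into_trancl)
  next
    case (step y z)
    then have "z \<in> A" using R no by auto
    with step show ?case by (auto intro: trancl_into_trancl)
  qed
  have bwd: "y \<in> B \<and> (y, x) \<in> (R \<inter> B \<times> B)\<^sup>+" if "(y, x) \<in> R\<^sup>+" "x \<in> B" for y
    using that
  proof (induction rule: converse_trancl_induct)
    case (base y)
    then show ?case using R no by (auto intro!: r_into_trancl)
  next
    case (step y z)
    then have "y \<in> B" using R no by auto
    with step show ?case by (auto intro: trancl_into_trancl2)
  qed
  have "x \<in> A \<or> x \<in> B" using x R by (metis SigmaD1 UnE converse_tranclE subsetD)
  then show False using fwd[OF x] bwd[OF x] assms(3,4) by (auto simp: acyclic_def)
qed

text \<open>In a cycle-free graph two vertices cannot precede each other, so the order condition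
  forbids directed paths from \<open>V1\<close> to \<open>V2\<close>. Such a path would have to
  cross from \<open>V1\<close> to \<open>V2\<close> along a single arc. The resulting local
  condition is the one used for restrictions and contractions.\<close>

lemma admissible_cut_iff:
  assumes "feynman G" "cycle_free G"
  shows "admissible_cut G V1 V2 \<longleftrightarrow> V1 \<inter> V2 = {} \<and> V1 \<union> V2 = verts G \<and>
    (\<forall>v w. (v, w) \<in> arcs G \<longrightarrow> v \<in> V1 \<longrightarrow> w \<notin> V2)" (is "_ \<longleftrightarrow> ?R")
proof
  have ac: "acyclic (arcs G)" using assms by (simp add: cycle_free_iff_acyclic)
  {
    assume "admissible_cut G V1 V2"
    then show ?R using ac unfolding admissible_cut_def vless_def acyclic_def
      by (metis r_into_trancl' trancl_trans)
  next
    assume R: ?R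
    have "w \<in> V1" if "(v, w) \<in> (arcs G)\<^sup>+" "v \<in> V1" for v w
      using that
      by (induction rule: trancl_induct) (use R arcs_in_verts[OF assms(1)] in blast)+
    then show "admissible_cut G V1 V2"
      using R unfolding admissible_cut_def vless_def by blast
  }
qed

section \<open>Restriction to a set of vertices\<close>

lemma restrict_end_simps [simp]:
  "restrict_end P None = None"
  "restrict_end P (Some v) = (if v \<in> P then Some v else None)"
  by (auto simp: restrict_end_def)

lemma restrict_end_eq_Some [simp]: "restrict_end P x = Some v \<longleftrightarrow> x = Some v \<and> v \<in> P"
  by (cases x) auto

lemma subgraph_simps [simp]:
  "verts (subgraph G P) = P"
  "edges (subgraph G P) =
     {e \<in> edges G. restrict_end P (src G e) \<noteq> None \<or> restrict_end P (tgt G e) \<noteq> None}"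
  "src (subgraph G P) e = restrict_end P (src G e)"
  "tgt (subgraph G P) e = restrict_end P (tgt G e)"
  "etype (subgraph G P) = etype G"
  by (simp_all add: subgraph_def)

lemma arcs_subgraph: "arcs (subgraph G P) = arcs G \<inter> P \<times> P"
  by (auto simp: arcs_def internal_edges_def)

lemma feynman_subgraph: "feynman G \<Longrightarrow> P \<subseteq> verts G \<Longrightarrow> feynman (subgraph G P)"
  by (auto simp: feynman_def finite_subset elem_set)

lemma cycle_free_subgraph: "cycle_free G \<Longrightarrow> cycle_free (subgraph G P)"
  unfolding cycle_free_iff_acyclic arcs_subgraph by (auto intro: acyclic_subset)

text \<open>Ends opened by restricting to \<open>V\<close> lie outside \<open>P\<close> and would be
  opened anyway. This is an equality of records, hence usable for rewriting, and not only an
  isomorphism.\<close>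

lemma subgraph_subgraph:
  assumes "P \<subseteq> V"
  shows "subgraph (subgraph G V) P = subgraph G P"
proof -
  have "restrict_end P (restrict_end V x) = restrict_end P x" for x
    using assms by (cases x) auto
  moreover have "restrict_end P x = None" if "restrict_end V x = None" for x
    using assms that by (cases x) (auto split: if_splits)
  ultimately show ?thesis using subsetD[OF assms] by (auto simp: subgraph_def)
qed

section \<open>Connected components and splittings without arcs between the two sides\<close>

lemma equiv_linked: "equiv (verts G) (linked G)"
proof (rule equivI)
  show "linked G \<subseteq> verts G \<times> verts G" "refl_on (verts G) (linked G)"
    by (auto simp: linked_def refl_on_def)
  have "sym ((arcs G \<union> (arcs G)\<inverse>)\<^sup>*)"
    by (rule sym_rtrancl) (auto simp: sym_def)
  then show "sym (linked G)" by (auto simp: linked_def sym_def)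
  show "trans (linked G)" by (auto simp: linked_def trans_def intro: rtrancl_trans)
qed

lemma components_partition: "partition_on (verts G) (components G)"
  unfolding components_def by (rule partition_on_quotient) (rule equiv_linked)

text \<open>This describes \<open>G\<close> as a disjoint union of two restrictions. The sides may
  be disconnected or empty, so one notion serves both for splitting off a component and for disjoint
  unions.\<close>

definition separated :: "('v, 'e, 't) fgraph \<Rightarrow> 'v set \<Rightarrow> 'v set \<Rightarrow> bool" where
  "separated G V1 V2 \<longleftrightarrow> V1 \<inter> V2 = {} \<and> V1 \<union> V2 = verts G \<and> arcs G \<subseteq> V1 \<times> V1 \<union> V2 \<times> V2"

lemma separated_sym: "separated G V1 V2 \<Longrightarrow> separated G V2 V1"
  by (auto simp: separated_def)

text \<open>An undirected walk that starts in \<open>V1\<close> never leaves \<open>V1\<close>,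
  since no arc joins the two sides.\<close>

lemma linked_separated:
  assumes "separated G V1 V2" "v \<in> V1"
  shows "linked G `` {v} = linked (subgraph G V1) `` {v}"
proof -
  let ?R = "arcs G \<union> (arcs G)\<inverse>" and ?R1 = "arcs G \<inter> V1 \<times> V1 \<union> (arcs G \<inter> V1 \<times> V1)\<inverse>"
  have "w \<in> V1 \<and> (v, w) \<in> ?R1\<^sup>*" if "(v, w) \<in> ?R\<^sup>*" for w
    using that
  proof (induction rule: rtrancl_induct)
    case base
    then show ?case using assms by simp
  next
    case (step y z)
    then have "(y, z) \<in> ?R1" using assms by (auto simp: separated_def)
    with step show ?case by (meson IntE Un_iff converseD mem_Sigma_iff rtrancl.rtrancl_into_rtrancl)
  qed
  moreover have "?R1\<^sup>* \<subseteq> ?R\<^sup>*" by (rule rtrancl_mono) auto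
  moreover have "V1 \<subseteq> verts G" using assms by (auto simp: separated_def)
  ultimately show ?thesis using assms(2) by (auto simp: linked_def arcs_subgraph)
qed

lemma components_separated:
  assumes "separated G V1 V2"
  shows "components G = components (subgraph G V1) \<union> components (subgraph G V2)"
proof -
  have "components G = (\<lambda>v. linked G `` {v}) ` V1 \<union> (\<lambda>v. linked G `` {v}) ` V2"
    using assms by (auto simp: components_def quotient_def separated_def)
  also have "\<dots> = (\<lambda>v. linked (subgraph G V1) `` {v}) ` V1 \<union> (\<lambda>v. linked (subgraph G V2) `` {v}) ` V2"
    using linked_separated[OF assms] linked_separated[OF separated_sym[OF assms]]
    by (auto simp: image_iff)
  finally show ?thesis by (auto simp: components_def quotient_def)
qed

lemma finite_components: "feynman G \<Longrightarrow> finite (components G)"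
  using components_partition[of G] finite_elements feynmanD(1) by blast

lemma component_subset: "P \<in> components G \<Longrightarrow> P \<subseteq> verts G"
  using components_partition[of G] by (auto simp: partition_on_def)

lemma graph_monomial_separated:
  assumes G: "feynman G" and sep: "separated G V1 V2"
  shows "graph_monomial G = graph_monomial (subgraph G V1) + graph_monomial (subgraph G V2)"
proof -
  let ?C1 = "components (subgraph G V1)" and ?C2 = "components (subgraph G V2)"
  have V: "V1 \<subseteq> verts G" "V2 \<subseteq> verts G" using sep by (auto simp: separated_def)
  have fin: "finite ?C1" "finite ?C2"
    using finite_components feynman_subgraph G V by blast+
  \<comment> \<open>A component common to both sides would be counted once by
    \<open>mset_set\<close> but twice in the sum. It cannot exist, as components are
    nonempty.\<close>
  have "?C1 \<inter> ?C2 = {}"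
  proof (rule ccontr)
    assume "?C1 \<inter> ?C2 \<noteq> {}"
    then obtain P where "P \<in> ?C1" "P \<in> ?C2" by auto
    then have "P \<subseteq> V1" "P \<subseteq> V2" "P \<noteq> {}"
      using component_subset[of P "subgraph G V1"] component_subset[of P "subgraph G V2"]
        components_partition[of "subgraph G V1"] by (auto simp: partition_on_def)
    then show False using sep by (auto simp: separated_def)
  qed
  then have "graph_monomial G = image_mset (\<lambda>P. ccf (subgraph G P)) (mset_set ?C1)
      + image_mset (\<lambda>P. ccf (subgraph G P)) (mset_set ?C2)"
    using fin by (simp add: graph_monomial_def components_separated[OF sep] mset_set_Union)
  also have "image_mset (\<lambda>P. ccf (subgraph G P)) (mset_set ?C1) = graph_monomial (subgraph G V1)"
    unfolding graph_monomial_def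
    by (rule image_mset_cong) (use fin component_subset in \<open>fastforce simp: subgraph_subgraph\<close>)
  also have "image_mset (\<lambda>P. ccf (subgraph G P)) (mset_set ?C2) = graph_monomial (subgraph G V2)"
    unfolding graph_monomial_def
    by (rule image_mset_cong) (use fin component_subset in \<open>fastforce simp: subgraph_subgraph\<close>)
  finally show ?thesis .
qed

text \<open>The two ends of an arc are linked, so they lie in the same equivalence class.\<close>

lemma component_separated:
  assumes "feynman G" "P \<in> components G"
  shows "separated G P (verts G - P)"
proof -
  have P: "P \<subseteq> verts G" using assms component_subset by blast
  have "w \<in> P \<longleftrightarrow> v \<in> P" if "(v, w) \<in> arcs G" for v w
  proof -
    have "(v, w) \<in> linked G" "(w, v) \<in> linked G"
      using that arcs_in_verts[OF assms(1) that] by (auto simp: linked_def)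
    then show ?thesis using assms(2) equiv_linked in_quotient_imp_closed
      unfolding components_def by metis
  qed
  then show ?thesis using P arcs_in_verts[OF assms(1)] by (fastforce simp: separated_def)
qed

lemma gconnected_component:
  assumes "feynman G" "P \<in> components G"
  shows "gconnected (subgraph G P)"
proof -
  have sep: "separated G P (verts G - P)" using assms by (rule component_separated)
  obtain v where v: "v \<in> verts G" "P = linked G `` {v}"
    using assms(2) by (auto simp: components_def elim: quotientE)
  have "v \<in> P" using v by (auto simp: linked_def)
  then have "linked (subgraph G P) `` {v} = P"
    by (rule trans[OF linked_separated[OF sep, symmetric] v(2)[symmetric]])
  then have "\<forall>w\<in>P. (v, w) \<in> linked (subgraph G P)" by blast
  moreover have "equiv P (linked (subgraph G P))" using equiv_linked[of "subgraph G P"] by simp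
  ultimately have "linked (subgraph G P) = P \<times> P"
    unfolding equiv_def sym_def trans_def by blast
  then show ?thesis using \<open>v \<in> P\<close> by (auto simp: gconnected_def)
qed

lemma components_gconnected: "gconnected G \<Longrightarrow> components G = {verts G}"
  by (auto simp: gconnected_def components_def quotient_def)

text \<open>Equality may fail: \<open>src\<close> and \<open>tgt\<close> are total functions, and
  restriction can change their values off \<open>edges G\<close>.\<close>

lemma subgraph_verts_iso: "feynman G \<Longrightarrow> fgraph_iso (subgraph G (verts G)) G"
proof -
  assume G: "feynman G"
  have *: "restrict_end (verts G) (src G e) = src G e \<and> restrict_end (verts G) (tgt G e) = tgt G e"
    if "e \<in> edges G" for e
    using feynmanD(3,4)[OF G that] by (cases "src G e"; cases "tgt G e") auto
  have "edges (subgraph G (verts G)) = edges G"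
    using feynmanD(3-5)[OF G] by simp blast
  then show ?thesis unfolding fgraph_iso_def
    by (intro exI[of _ id]) (use * in \<open>auto simp: option.map_id\<close>)
qed

section \<open>Invariance under isomorphism\<close>

text \<open>The vertex and edge maps are named because the same maps must induce isomorphisms of
  subgraphs and contractions.\<close>

definition iso_via ::
  "('v \<Rightarrow> 'w) \<Rightarrow> ('e \<Rightarrow> 'f) \<Rightarrow> ('v, 'e, 't) fgraph \<Rightarrow> ('w, 'f, 't) fgraph \<Rightarrow> bool" where
  "iso_via f g G H \<longleftrightarrow> bij_betw f (verts G) (verts H) \<and> bij_betw g (edges G) (edges H) \<and>
     (\<forall>e\<in>edges G. src H (g e) = map_option f (src G e) \<and> tgt H (g e) = map_option f (tgt G e) \<and>
        etype H (g e) = etype G e)"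

lemma fgraph_iso_iff: "fgraph_iso G H \<longleftrightarrow> (\<exists>f g. iso_via f g G H)"
  by (simp add: fgraph_iso_def iso_via_def)

lemma iso_viaD:
  assumes "iso_via f g G H"
  shows "bij_betw f (verts G) (verts H)" "bij_betw g (edges G) (edges H)"
    "inj_on f (verts G)" "f ` verts G = verts H" "inj_on g (edges G)" "g ` edges G = edges H"
    "\<And>e. e \<in> edges G \<Longrightarrow> g e \<in> edges H"
    "\<And>e. e \<in> edges G \<Longrightarrow> src H (g e) = map_option f (src G e)"
    "\<And>e. e \<in> edges G \<Longrightarrow> tgt H (g e) = map_option f (tgt G e)"
    "\<And>e. e \<in> edges G \<Longrightarrow> etype H (g e) = etype G e"
  using assms by (auto simp: iso_via_def bij_betw_def)

lemma fgraph_iso_trans: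
  assumes "fgraph_iso G H" "fgraph_iso H K"
  shows "fgraph_iso G K"
proof -
  obtain f g f' g' where i: "iso_via f g G H" "iso_via f' g' H K"
    using assms by (auto simp: fgraph_iso_iff)
  have "iso_via (f' \<circ> f) (g' \<circ> g) G K"
    unfolding iso_via_def
    using bij_betw_trans[OF iso_viaD(1)[OF i(1)] iso_viaD(1)[OF i(2)]]
      bij_betw_trans[OF iso_viaD(2)[OF i(1)] iso_viaD(2)[OF i(2)]]
    by (auto simp: iso_viaD(7-10)[OF i(1)] iso_viaD(8-10)[OF i(2)] option.map_comp)
  then show ?thesis by (auto simp: fgraph_iso_iff)
qed

text \<open>\<open>inv_into\<close> cancels \<open>f\<close> only on \<open>verts G\<close>; the
  Feynman condition guarantees that all ends of edges lie there.\<close>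

lemma iso_via_inverse:
  assumes G: "feynman G" and i: "iso_via f g G H"
  shows "iso_via (inv_into (verts G) f) (inv_into (edges G) g) H G"
proof -
  let ?f = "inv_into (verts G) f" and ?g = "inv_into (edges G) g"
  note D = iso_viaD[OF i]
  have "src G (?g e) = map_option ?f (src H e) \<and> tgt G (?g e) = map_option ?f (tgt H e) \<and>
        etype G (?g e) = etype H e" if "e \<in> edges H" for e
  proof -
    obtain d where d: "d \<in> edges G" "e = g d" using \<open>e \<in> edges H\<close> unfolding D(6)[symmetric] by blast
    have "?g e = d" using d D(5) by simp
    moreover have "map_option ?f (map_option f x) = x" if "set_option x \<subseteq> verts G" for x
      using that D(3) by (cases x) auto
    ultimately show ?thesis using d D(8-10)[OF d(1)] G by (auto simp: feynman_def)
  qed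
  then show ?thesis
    unfolding iso_via_def using bij_betw_inv_into[OF D(1)] bij_betw_inv_into[OF D(2)] by blast
qed

lemma fgraph_iso_sym: "feynman G \<Longrightarrow> fgraph_iso G H \<Longrightarrow> fgraph_iso H G"
  unfolding fgraph_iso_iff using iso_via_inverse by blast

lemma feynman_iso_via:
  assumes i: "iso_via f g G H" and G: "feynman G"
  shows "feynman H"
proof -
  note D = iso_viaD[OF i]
  have "set_option (src H e) \<subseteq> verts H \<and> set_option (tgt H e) \<subseteq> verts H \<and>
        \<not> (src H e = None \<and> tgt H e = None)" if "e \<in> edges H" for e
  proof -
    obtain d where d: "d \<in> edges G" "e = g d" using \<open>e \<in> edges H\<close> unfolding D(6)[symmetric] by blast
    then show ?thesis
      using D(8,9)[OF d(1)] feynmanD(3-5)[OF G d(1)] D(4)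
      by (cases "src G d"; cases "tgt G d") auto
  qed
  then show ?thesis
    using G D(4,6) unfolding feynman_def by (metis finite_imageI)
qed

lemma arcs_iso_via:
  assumes i: "iso_via f g G H"
  shows "arcs H = map_prod f f ` arcs G"
proof -
  note D = iso_viaD[OF i]
  have "(v, w) \<in> map_prod f f ` arcs G" if "(v, w) \<in> arcs H" for v w
  proof -
    obtain e where e: "e \<in> edges H" "src H e = Some v" "tgt H e = Some w"
      using \<open>(v, w) \<in> arcs H\<close> by (rule arcsE)
    then obtain d where d: "d \<in> edges G" "e = g d" unfolding D(6)[symmetric] by blast
    then obtain v' w' where "src G d = Some v'" "v = f v'" "tgt G d = Some w'" "w = f w'"
      using e D(8,9)[OF d(1)] by auto
    then show ?thesis using arcsI[OF d(1)] by force
  qed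
  moreover have "(f v, f w) \<in> arcs H" if "(v, w) \<in> arcs G" for v w
  proof -
    obtain e where e: "e \<in> edges G" "src G e = Some v" "tgt G e = Some w"
      using \<open>(v, w) \<in> arcs G\<close> by (rule arcsE)
    then show ?thesis using arcsI[of "g e" H] D(7-9)[OF e(1)] by simp
  qed
  ultimately show ?thesis by auto
qed

text \<open>The inverse isomorphism carries a closed walk of \<open>H\<close> back to one of
  \<open>G\<close>.\<close>

lemma cycle_free_iso_via:
  assumes i: "iso_via f g G H" and G: "feynman G" "cycle_free G"
  shows "cycle_free H"
proof -
  let ?f = "inv_into (verts G) f"
  have arcs: "arcs G = map_prod ?f ?f ` arcs H"
    using arcs_iso_via[OF iso_via_inverse[OF G(1) i]] .
  have "(?f v, ?f w) \<in> (arcs G)\<^sup>+" if "(v, w) \<in> (arcs H)\<^sup>+" for v w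
    using that
  proof (induction rule: trancl_induct)
    case (base y)
    then show ?case unfolding arcs by force
  next
    case (step y z)
    then have "(?f y, ?f z) \<in> arcs G" unfolding arcs by force
    with step show ?case by (meson trancl.trancl_into_trancl)
  qed
  then show ?thesis using G(2) unfolding cycle_free_iff_acyclic acyclic_def by blast
qed

lemma linked_iso_via_imp:
  assumes i: "iso_via f g G H" and vw: "(v, w) \<in> linked G"
  shows "(f v, f w) \<in> linked H"
proof -
  let ?R = "arcs G \<union> (arcs G)\<inverse>" and ?S = "arcs H \<union> (arcs H)\<inverse>"
  have "(f v, f w) \<in> ?S\<^sup>*" if "(v, w) \<in> ?R\<^sup>*" for v w
    using that
  proof (induction rule: rtrancl_induct)
    case (step y z)
    then have "(f y, f z) \<in> ?S" unfolding arcs_iso_via[OF i] by force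
    with step show ?case by (meson rtrancl.rtrancl_into_rtrancl)
  qed simp
  then show ?thesis using vw iso_viaD(4)[OF i] by (auto simp: linked_def)
qed

text \<open>Isomorphisms preserve links; one inclusion applies this to the given isomorphism, the
  other to its inverse.\<close>

lemma linked_iso_via:
  assumes i: "iso_via f g G H" and G: "feynman G" and v: "v \<in> verts G"
  shows "linked H `` {f v} = f ` (linked G `` {v})"
proof
  note D = iso_viaD[OF i]
  let ?f = "inv_into (verts G) f"
  show "linked H `` {f v} \<subseteq> f ` (linked G `` {v})"
  proof
    fix w assume "w \<in> linked H `` {f v}"
    then have w: "(f v, w) \<in> linked H" by simp
    then have "(?f (f v), ?f w) \<in> linked G"
      using linked_iso_via_imp[OF iso_via_inverse[OF G i]] by blast
    moreover have "w \<in> verts H" using w by (simp add: linked_def)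
    ultimately show "w \<in> f ` (linked G `` {v})"
      using v D(3,4) by (auto simp: f_inv_into_f image_iff intro!: bexI[of _ "?f w"])
  qed
  show "f ` (linked G `` {v}) \<subseteq> linked H `` {f v}"
    using linked_iso_via_imp[OF i] by auto
qed

lemma components_iso_via:
  assumes "iso_via f g G H" "feynman G"
  shows "components H = (\<lambda>P. f ` P) ` components G"
proof -
  have "components H = (\<lambda>v. linked H `` {f v}) ` verts G"
    unfolding components_def quotient_def iso_viaD(4)[OF assms(1), symmetric] by blast
  also have "\<dots> = (\<lambda>v. f ` (linked G `` {v})) ` verts G"
    by (rule image_cong) (auto simp: linked_iso_via[OF assms])
  finally show ?thesis by (auto simp: components_def quotient_def)
qed

text \<open>In this form connectedness is transported along isomorphisms together with the set of
  components.\<close>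

lemma gconnected_iff_components: "gconnected G \<longleftrightarrow> components G = {verts G}"
proof
  show "gconnected G \<Longrightarrow> components G = {verts G}" by (rule components_gconnected)
  assume c: "components G = {verts G}"
  then have "verts G \<noteq> {}" by (auto simp: components_def)
  moreover have "linked G `` {v} = verts G" if "v \<in> verts G" for v
    using c quotientI[OF that, of "linked G"] by (simp add: components_def)
  moreover have "linked G \<subseteq> verts G \<times> verts G" by (auto simp: linked_def)
  ultimately show "gconnected G" by (auto simp: gconnected_def)
qed

lemma gconnected_iso_via:
  assumes "iso_via f g G H" "feynman G" "gconnected G"
  shows "gconnected H"
  using assms components_iso_via[OF assms(1,2)] iso_viaD(4)[OF assms(1)]
  by (simp add: gconnected_iff_components)

lemma restrict_end_map_option:
  assumes "inj_on f A" "P \<subseteq> A" "set_option x \<subseteq> A"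
  shows "restrict_end (f ` P) (map_option f x) = map_option f (restrict_end P x)"
  using assms by (cases x) (auto simp: inj_on_image_mem_iff)

lemma subgraph_iso_via:
  assumes i: "iso_via f g G H" and G: "feynman G" and P: "P \<subseteq> verts G"
  shows "iso_via f g (subgraph G P) (subgraph H (f ` P))"
proof -
  note D = iso_viaD[OF i]
  have r: "restrict_end (f ` P) (src H (g e)) = map_option f (restrict_end P (src G e))"
    "restrict_end (f ` P) (tgt H (g e)) = map_option f (restrict_end P (tgt G e))"
    if "e \<in> edges G" for e
    using that D(8,9)[OF that] G restrict_end_map_option[OF D(3) P]
    by (auto simp: feynman_def)
  have "{e \<in> edges G. restrict_end (f ` P) (src H (g e)) \<noteq> None \<or> restrict_end (f ` P) (tgt H (g e)) \<noteq> None}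
      = edges (subgraph G P)"
    unfolding subgraph_simps by (rule Collect_cong) (simp add: r cong: conj_cong del: not_None_eq)
  then have "g ` edges (subgraph G P) = edges (subgraph H (f ` P))"
    unfolding subgraph_simps D(6)[symmetric] by blast
  moreover have "inj_on g (edges (subgraph G P))"
    by (rule inj_on_subset[OF D(5)]) auto
  moreover have "inj_on f P" using D(3) P by (rule inj_on_subset)
  ultimately show ?thesis
    using r D(10) by (auto simp: iso_via_def bij_betw_def)
qed

section \<open>Isomorphism classes and monomials\<close>

lemma iso_class_iso:
  assumes "feynman G" "fgraph_iso G H"
  shows "iso_class G = iso_class H"
proof -
  have "fgraph_iso G K \<longleftrightarrow> fgraph_iso H K" for K :: "(nat, nat, 'c) fgraph"
    using fgraph_iso_trans[OF assms(2)] fgraph_iso_trans[OF fgraph_iso_sym[OF assms]] by blast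
  then show ?thesis by (simp add: iso_class_def)
qed

lemma ccf_iso: "feynman G \<Longrightarrow> fgraph_iso G H \<Longrightarrow> ccf G = ccf H"
  by (simp add: ccf_def iso_class_iso)

text \<open>Finite vertex and edge sets embed into the natural numbers, and the structure is
  transported along the embeddings. In particular \<open>iso_class\<close> of a Feynman graph is
  never empty.\<close>

lemma nat_model:
  fixes G :: "('v, 'e, 't) fgraph"
  assumes "feynman G"
  obtains H :: "(nat, nat, 't) fgraph" where "fgraph_iso G H"
proof -
  obtain f :: "'v \<Rightarrow> nat" where f: "inj_on f (verts G)"
    using finite_imp_inj_to_nat_seg[OF feynmanD(1)[OF assms]] by blast
  obtain g :: "'e \<Rightarrow> nat" where g: "inj_on g (edges G)"
    using finite_imp_inj_to_nat_seg[OF feynmanD(2)[OF assms]] by blast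
  let ?g = "inv_into (edges G) g"
  let ?H = "\<lparr>verts = f ` verts G, edges = g ` edges G, src = \<lambda>e. map_option f (src G (?g e)),
    tgt = \<lambda>e. map_option f (tgt G (?g e)), etype = \<lambda>e. etype G (?g e)\<rparr>"
  have "iso_via f g G ?H" using f g by (auto simp: iso_via_def bij_betw_def)
  then show thesis using that fgraph_iso_iff by blast
qed

lemma feynman_iso: "feynman G \<Longrightarrow> fgraph_iso G H \<Longrightarrow> feynman H"
  and cycle_free_iso: "feynman G \<Longrightarrow> fgraph_iso G H \<Longrightarrow> cycle_free G \<Longrightarrow> cycle_free H"
  and gconnected_iso: "feynman G \<Longrightarrow> fgraph_iso G H \<Longrightarrow> gconnected G \<Longrightarrow> gconnected H"
  unfolding fgraph_iso_iff using feynman_iso_via cycle_free_iso_via gconnected_iso_via by blast+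

text \<open>\<open>Abs_ccf_graph\<close> is injective only on classes of connected cycle-free
  graphs, so both classes are first shown to have such a representative over \<open>nat\<close>. A
  numbered model of \<open>G\<close> then lies in the class of \<open>H\<close> as well and connects
  the two graphs.\<close>

lemma iso_of_ccf_eq:
  fixes G :: "('v, 'e, 't) fgraph" and H :: "('w, 'f, 't) fgraph"
  assumes G: "feynman G" "cycle_free G" "gconnected G"
    and H: "feynman H" "cycle_free H" "gconnected H" and eq: "ccf G = ccf H"
  shows "fgraph_iso G H"
proof -
  have mem: "iso_class K \<in> {iso_class G | G :: (nat, nat, 't) fgraph. feynman G \<and> cycle_free G \<and> gconnected G}"
    if K: "feynman K" "cycle_free K" "gconnected K" for K :: "('x, 'y, 't) fgraph"
  proof -
    obtain L :: "(nat, nat, 't) fgraph" where L: "fgraph_iso K L" using nat_model K by blast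
    then show ?thesis
      using iso_class_iso[OF K(1) L] feynman_iso[OF K(1) L] cycle_free_iso[OF K(1) L K(2)]
        gconnected_iso[OF K(1) L K(3)] by blast
  qed
  have "iso_class G = iso_class H"
    using eq mem[OF G] mem[OF H] by (simp add: ccf_def Abs_ccf_graph_inject)
  moreover obtain L :: "(nat, nat, 't) fgraph" where L: "fgraph_iso G L" using nat_model G by blast
  ultimately have "fgraph_iso H L"
    using feynman_iso[OF G(1) L] by (auto simp: iso_class_def)
  then show ?thesis using L fgraph_iso_sym[OF H(1)] fgraph_iso_trans by blast
qed

lemma graph_monomial_iso:
  assumes G: "feynman G" and "fgraph_iso G H"
  shows "graph_monomial G = graph_monomial H"
proof -
  obtain f g where i: "iso_via f g G H" using assms fgraph_iso_iff by blast
  \<comment> \<open>Distinct components must have distinct images, since otherwise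
    \<open>mset_set\<close> of the image would lose multiplicities.\<close>
  have inj: "inj_on (\<lambda>P. f ` P) (components G)"
    using iso_viaD(3)[OF i] partition_onD1[OF components_partition[of G]] by (simp add: inj_on_image)
  have "graph_monomial H = image_mset (\<lambda>P. ccf (subgraph H (f ` P))) (mset_set (components G))"
    unfolding graph_monomial_def components_iso_via[OF i G]
    by (simp add: image_mset_mset_set[OF inj, symmetric] multiset.map_comp comp_def)
  also have "\<dots> = graph_monomial G"
    unfolding graph_monomial_def
  proof (rule image_mset_cong)
    fix P assume "P \<in># mset_set (components G)"
    then have P: "P \<subseteq> verts G" using component_subset finite_components[OF G] by simp
    then have "fgraph_iso (subgraph G P) (subgraph H (f ` P))"
      using subgraph_iso_via[OF i G] fgraph_iso_iff by blast
    then show "ccf (subgraph H (f ` P)) = ccf (subgraph G P)"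
      by (rule ccf_iso[OF feynman_subgraph[OF G P], symmetric])
  qed
  finally show ?thesis by simp
qed

section \<open>Gluing isomorphisms and recovering a graph from its monomial\<close>

lemma edges_separated:
  assumes G: "feynman G" and sep: "separated G V1 V2"
  shows "edges G = edges (subgraph G V1) \<union> edges (subgraph G V2)"
    and "edges (subgraph G V1) \<inter> edges (subgraph G V2) = {}"
proof -
  have in_V: "v \<in> V1 \<or> v \<in> V2" if "e \<in> edges G" "src G e = Some v \<or> tgt G e = Some v" for e v
    using feynmanD(3,4)[OF G that(1)] that(2) sep by (auto simp: separated_def)
  then show "edges G = edges (subgraph G V1) \<union> edges (subgraph G V2)"
    using feynmanD(5)[OF G] by fastforce
  show "edges (subgraph G V1) \<inter> edges (subgraph G V2) = {}"
    using sep arcsI[of _ G] by (fastforce simp: separated_def)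
qed

text \<open>Restriction to one side of a separation opens no end: an edge meeting both sides would
  belong to both restrictions.\<close>

lemma ends_separated:
  assumes G: "feynman G" and sep: "separated G V1 V2" and e: "e \<in> edges (subgraph G V1)"
  shows "src (subgraph G V1) e = src G e" "tgt (subgraph G V1) e = tgt G e"
proof -
  have "e \<in> edges G" using e by simp
  have "v \<in> V1" if "src G e = Some v \<or> tgt G e = Some v" for v
  proof (rule ccontr)
    assume "v \<notin> V1"
    then have "v \<in> V2"
      using feynmanD(3,4)[OF G \<open>e \<in> edges G\<close>] that sep by (auto simp: separated_def)
    then have "e \<in> edges (subgraph G V2)" using that \<open>e \<in> edges G\<close> by auto
    then show False using edges_separated(2)[OF G sep] e by blast
  qed
  moreover have "restrict_end V1 x = x" if "\<And>v. x = Some v \<Longrightarrow> v \<in> V1" for x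
    using that by (cases x) auto
  ultimately show "src (subgraph G V1) e = src G e" "tgt (subgraph G V1) e = tgt G e"
    unfolding subgraph_simps by blast+
qed

lemma bij_betw_if:
  assumes "bij_betw f1 A1 B1" "bij_betw f2 A2 B2" "A1 \<inter> A2 = {}" "B1 \<inter> B2 = {}"
  shows "bij_betw (\<lambda>x. if x \<in> A1 then f1 x else f2 x) (A1 \<union> A2) (B1 \<union> B2)"
proof (rule bij_betw_combine)
  show "bij_betw (\<lambda>x. if x \<in> A1 then f1 x else f2 x) A1 B1"
    using assms(1) by (rule bij_betw_cong[THEN iffD1, rotated]) simp
  show "bij_betw (\<lambda>x. if x \<in> A1 then f1 x else f2 x) A2 B2"
    using assms(2) by (rule bij_betw_cong[THEN iffD1, rotated]) (use assms(3) in auto)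
qed (rule assms(4))

text \<open>The two sides partition the vertices and also the edges, so the vertex maps and the edge
  maps can be combined by cases.\<close>

lemma iso_glue:
  assumes G: "feynman G" and H: "feynman H"
    and sG: "separated G V1 V2" and sH: "separated H W1 W2"
    and "fgraph_iso (subgraph G V1) (subgraph H W1)" "fgraph_iso (subgraph G V2) (subgraph H W2)"
  shows "fgraph_iso G H"
proof -
  obtain f1 g1 f2 g2 where i1: "iso_via f1 g1 (subgraph G V1) (subgraph H W1)"
    and i2: "iso_via f2 g2 (subgraph G V2) (subgraph H W2)"
    using assms(5,6) fgraph_iso_iff by blast
  let ?f = "\<lambda>v. if v \<in> V1 then f1 v else f2 v"
  let ?E1 = "edges (subgraph G V1)" and ?E2 = "edges (subgraph G V2)"
  let ?g = "\<lambda>e. if e \<in> ?E1 then g1 e else g2 e"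
  have dV: "V1 \<inter> V2 = {}" "W1 \<inter> W2 = {}" "verts G = V1 \<union> V2" "verts H = W1 \<union> W2"
    using sG sH by (auto simp: separated_def)
  have "bij_betw ?f (verts G) (verts H)"
    unfolding dV(3,4) using iso_viaD(1)[OF i1] iso_viaD(1)[OF i2] dV(1,2)
    by (intro bij_betw_if) auto
  moreover have "bij_betw ?g (edges G) (edges H)"
    unfolding edges_separated(1)[OF G sG] edges_separated(1)[OF H sH]
    using iso_viaD(2)[OF i1] iso_viaD(2)[OF i2] edges_separated(2)[OF G sG] edges_separated(2)[OF H sH]
    by (rule bij_betw_if)
  moreover have "src H (?g e) = map_option ?f (src G e) \<and> tgt H (?g e) = map_option ?f (tgt G e) \<and>
      etype H (?g e) = etype G e" if e: "e \<in> edges G" for e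
  proof (cases "e \<in> ?E1")
    case True
    note e1 = iso_viaD(7)[OF i1 True]
    have H': "src H (g1 e) = map_option f1 (src G e)" "tgt H (g1 e) = map_option f1 (tgt G e)"
      "etype H (g1 e) = etype G e"
      using iso_viaD(8-10)[OF i1 True] ends_separated[OF G sG True]
        ends_separated[OF H sH e1] by (simp_all only: subgraph_simps(5))
    have "set_option (src G e) \<subseteq> V1" "set_option (tgt G e) \<subseteq> V1"
      using ends_separated[OF G sG True, symmetric] by (auto split: if_splits)
    then have "map_option f1 (src G e) = map_option ?f (src G e)"
      "map_option f1 (tgt G e) = map_option ?f (tgt G e)"
      by (auto intro!: option.map_cong0)
    then show ?thesis using True H' by simp
  next
    case False
    then have e2: "e \<in> ?E2" using e edges_separated(1)[OF G sG] by blast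
    note e3 = iso_viaD(7)[OF i2 e2]
    have H': "src H (g2 e) = map_option f2 (src G e)" "tgt H (g2 e) = map_option f2 (tgt G e)"
      "etype H (g2 e) = etype G e"
      using iso_viaD(8-10)[OF i2 e2] ends_separated[OF G separated_sym[OF sG] e2]
        ends_separated[OF H separated_sym[OF sH] e3] by (simp_all only: subgraph_simps(5))
    have "set_option (src G e) \<subseteq> V2" "set_option (tgt G e) \<subseteq> V2"
      using ends_separated[OF G separated_sym[OF sG] e2, symmetric] by (auto split: if_splits)
    then have "map_option f2 (src G e) = map_option ?f (src G e)"
      "map_option f2 (tgt G e) = map_option ?f (tgt G e)"
      using dV(1) by (auto intro!: option.map_cong0)
    then show ?thesis using False H' by (simp del: subgraph_simps)
  qed
  ultimately show ?thesis unfolding fgraph_iso_def by blast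
qed

text \<open>Induction on the number of vertices. A component \<open>P\<close> of \<open>G\<close>
  contributes a class that must come from a component \<open>Q\<close> of \<open>H\<close>, so the
  two are isomorphic. Cancelling this factor leaves equal monomials for the complements, and the
  isomorphism given by induction is glued to the first one.\<close>

lemma iso_of_graph_monomial_eq:
  fixes G :: "('v, 'e, 't) fgraph" and H :: "('w, 'f, 't) fgraph"
  assumes "feynman G" "cycle_free G" "feynman H" "cycle_free H" "graph_monomial G = graph_monomial H"
  shows "fgraph_iso G H"
  using assms
proof (induction "card (verts G)" arbitrary: G H rule: less_induct)
  case less
  note G = less.prems(1,2) and H = less.prems(3,4)
  have iff: "v \<in> \<Union>(components G) \<longleftrightarrow> v \<in> verts G" "w \<in> \<Union>(components H) \<longleftrightarrow> w \<in> verts H" for v w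
    using partition_onD1[OF components_partition] by metis+
  show ?case
  proof (cases "verts G = {}")
    case True
    then have "components G = {}" by (simp add: components_def)
    then have "graph_monomial H = {#}" using less.prems(5) by (simp add: graph_monomial_def)
    then have "components H = {}"
      using finite_components[OF H(1)] by (simp add: graph_monomial_def mset_set_empty_iff)
    then have "verts H = {}" using iff(2) by blast
    \<comment> \<open>Every edge of a Feynman graph has at least one end at a vertex, so no edge
      remains.\<close>
    then have "edges G = {}" "edges H = {}"
      using True feynmanD(3-5)[OF G(1)] feynmanD(3-5)[OF H(1)] by (metis all_not_in_conv option.exhaust)+
    then show ?thesis
      using True \<open>verts H = {}\<close> by (simp add: fgraph_iso_def bij_betw_def)
  next
    case False
    then obtain P where P: "P \<in> components G" using iff(1) by blast
    have Psub: "P \<subseteq> verts G" "P \<noteq> {}"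
      using P component_subset components_partition[of G] by (auto simp: partition_on_def)
    have "ccf (subgraph G P) \<in># graph_monomial G"
      using P finite_components[OF G(1)] by (auto simp: graph_monomial_def)
    then have "ccf (subgraph G P) \<in># graph_monomial H" unfolding less.prems(5) .
    then obtain Q where Q: "Q \<in> components H" and eq: "ccf (subgraph G P) = ccf (subgraph H Q)"
      using finite_components[OF H(1)] by (auto simp: graph_monomial_def)
    have Qsub: "Q \<subseteq> verts H" using Q by (rule component_subset)
    let ?V = "verts G - P" and ?W = "verts H - Q"
    have fG: "feynman (subgraph G P)" "feynman (subgraph G ?V)"
      and fH: "feynman (subgraph H Q)" "feynman (subgraph H ?W)"
      using G H Psub Qsub by (auto intro!: feynman_subgraph)
    have iso1: "fgraph_iso (subgraph G P) (subgraph H Q)"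
      using fG(1) fH(1) G H P Q eq by (intro iso_of_ccf_eq cycle_free_subgraph gconnected_component)
    have sG: "separated G P ?V" and sH: "separated H Q ?W"
      using component_separated G H P Q by blast+
    have "graph_monomial (subgraph G P) + graph_monomial (subgraph G ?V)
        = graph_monomial (subgraph H Q) + graph_monomial (subgraph H ?W)"
      using graph_monomial_separated[OF G(1) sG] graph_monomial_separated[OF H(1) sH] less.prems(5) by simp
    then have "graph_monomial (subgraph G ?V) = graph_monomial (subgraph H ?W)"
      using graph_monomial_iso[OF fG(1) iso1] by simp
    moreover have "card ?V < card (verts G)"
      using Psub feynmanD(1)[OF G(1)] by (intro psubset_card_mono) auto
    ultimately have iso2: "fgraph_iso (subgraph G ?V) (subgraph H ?W)"
      using fG fH G H by (intro less.hyps) (auto intro!: cycle_free_subgraph)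
    show ?thesis using iso_glue[OF G(1) H(1) sG sH iso1 iso2] .
  qed
qed


section \<open>Disjoint unions and realisation of every monomial by a graph\<close>

definition disjoint_union ::
  "('v, 'e, 't) fgraph \<Rightarrow> ('w, 'f, 't) fgraph \<Rightarrow> ('v + 'w, 'e + 'f, 't) fgraph" where
  "disjoint_union G H =
     \<lparr>verts = verts G <+> verts H, edges = edges G <+> edges H,
      src = case_sum (\<lambda>e. map_option Inl (src G e)) (\<lambda>e. map_option Inr (src H e)),
      tgt = case_sum (\<lambda>e. map_option Inl (tgt G e)) (\<lambda>e. map_option Inr (tgt H e)),
      etype = case_sum (etype G) (etype H)\<rparr>"

lemma disjoint_union_simps [simp]:
  "verts (disjoint_union G H) = Inl ` verts G \<union> Inr ` verts H"
  "edges (disjoint_union G H) = Inl ` edges G \<union> Inr ` edges H"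
  "src (disjoint_union G H) (Inl e) = map_option Inl (src G e)"
  "src (disjoint_union G H) (Inr d) = map_option Inr (src H d)"
  "tgt (disjoint_union G H) (Inl e) = map_option Inl (tgt G e)"
  "tgt (disjoint_union G H) (Inr d) = map_option Inr (tgt H d)"
  "etype (disjoint_union G H) (Inl e) = etype G e"
  "etype (disjoint_union G H) (Inr d) = etype H d"
  by (auto simp: disjoint_union_def)

lemma feynman_disjoint_union: "feynman G \<Longrightarrow> feynman H \<Longrightarrow> feynman (disjoint_union G H)"
  unfolding feynman_def by (fastforce simp: option.set_map subset_iff image_iff)

lemma disjoint_union_separated:
  assumes "feynman G" "feynman H"
  shows "separated (disjoint_union G H) (Inl ` verts G) (Inr ` verts H)"
  using assms
  by (auto simp: separated_def image_iff elim!: arcsE) (metis feynmanD(3,4))+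

lemma disjoint_union_left:
  assumes "feynman G"
  shows "fgraph_iso G (subgraph (disjoint_union G H) (Inl ` verts G))"
proof -
  have r: "restrict_end (Inl ` verts G) (map_option Inl (src G e)) = map_option Inl (src G e)"
    "restrict_end (Inl ` verts G) (map_option Inl (tgt G e)) = map_option Inl (tgt G e)"
    if "e \<in> edges G" for e
    using feynmanD(3,4)[OF assms that] by (cases "src G e"; cases "tgt G e"; auto)+
  have "restrict_end (Inl ` verts G) (src (disjoint_union G H) (Inl e)) \<noteq> None \<or>
      restrict_end (Inl ` verts G) (tgt (disjoint_union G H) (Inl e)) \<noteq> None" if "e \<in> edges G" for e
    using feynmanD(5)[OF assms that] by (simp only: disjoint_union_simps r[OF that] option.map_disc_iff)
  moreover have "\<not> (restrict_end (Inl ` verts G) (src (disjoint_union G H) (Inr e)) \<noteq> None \<or>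
      restrict_end (Inl ` verts G) (tgt (disjoint_union G H) (Inr e)) \<noteq> None)" for e
    by auto
  ultimately have "edges (subgraph (disjoint_union G H) (Inl ` verts G)) = Inl ` edges G"
    unfolding subgraph_simps disjoint_union_simps(2) by blast
  then show ?thesis
    unfolding fgraph_iso_def using r by (intro exI[of _ Inl]) (auto simp: bij_betw_def)
qed

lemma disjoint_union_right:
  assumes "feynman H"
  shows "fgraph_iso H (subgraph (disjoint_union G H) (Inr ` verts H))"
proof -
  have r: "restrict_end (Inr ` verts H) (map_option Inr (src H e)) = map_option Inr (src H e)"
    "restrict_end (Inr ` verts H) (map_option Inr (tgt H e)) = map_option Inr (tgt H e)"
    if "e \<in> edges H" for e
    using feynmanD(3,4)[OF assms that] by (cases "src H e"; cases "tgt H e"; auto)+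
  have "restrict_end (Inr ` verts H) (src (disjoint_union G H) (Inr e)) \<noteq> None \<or>
      restrict_end (Inr ` verts H) (tgt (disjoint_union G H) (Inr e)) \<noteq> None" if "e \<in> edges H" for e
    using feynmanD(5)[OF assms that] by (simp only: disjoint_union_simps r[OF that] option.map_disc_iff)
  moreover have "\<not> (restrict_end (Inr ` verts H) (src (disjoint_union G H) (Inl e)) \<noteq> None \<or>
      restrict_end (Inr ` verts H) (tgt (disjoint_union G H) (Inl e)) \<noteq> None)" for e
    by auto
  ultimately have "edges (subgraph (disjoint_union G H) (Inr ` verts H)) = Inr ` edges H"
    unfolding subgraph_simps disjoint_union_simps(2) by blast
  then show ?thesis
    unfolding fgraph_iso_def using r by (intro exI[of _ Inr]) (auto simp: bij_betw_def)
qed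

lemma graph_monomial_disjoint_union:
  assumes "feynman G" "feynman H"
  shows "graph_monomial (disjoint_union G H) = graph_monomial G + graph_monomial H"
  using graph_monomial_separated[OF feynman_disjoint_union[OF assms] disjoint_union_separated[OF assms]]
    graph_monomial_iso[OF assms(1) disjoint_union_left[OF assms(1)]]
    graph_monomial_iso[OF assms(2) disjoint_union_right[OF assms(2)]]
  by metis

text \<open>No arc joins the two summands, and each induced part is an isomorphic copy of a
  cycle-free graph.\<close>

lemma cycle_free_disjoint_union:
  assumes "feynman G" "feynman H" "cycle_free G" "cycle_free H"
  shows "cycle_free (disjoint_union G H)"
  unfolding cycle_free_iff_acyclic
proof (rule acyclic_two_parts[of _ "Inl ` verts G" "Inr ` verts H"])
  have sep: "separated (disjoint_union G H) (Inl ` verts G) (Inr ` verts H)"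
    using assms(1,2) by (rule disjoint_union_separated)
  then show "arcs (disjoint_union G H) \<subseteq> (Inl ` verts G \<union> Inr ` verts H) \<times> (Inl ` verts G \<union> Inr ` verts H)"
    unfolding separated_def by blast
  show "(x, y) \<in> arcs (disjoint_union G H) \<Longrightarrow> x \<in> Inl ` verts G \<Longrightarrow> y \<in> Inr ` verts H \<Longrightarrow> False" for x y
    using sep unfolding separated_def by blast
  show "acyclic (arcs (disjoint_union G H) \<inter> Inl ` verts G \<times> Inl ` verts G)"
    using cycle_free_iso[OF assms(1) disjoint_union_left[OF assms(1)] assms(3)]
    by (simp add: cycle_free_iff_acyclic arcs_subgraph)
  show "acyclic (arcs (disjoint_union G H) \<inter> Inr ` verts H \<times> Inr ` verts H)"
    using cycle_free_iso[OF assms(2) disjoint_union_right[OF assms(2)] assms(4)]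
    by (simp add: cycle_free_iff_acyclic arcs_subgraph)
qed

lemma graph_monomial_gconnected:
  assumes "feynman G" "gconnected G"
  shows "graph_monomial G = {#ccf G#}"
  using components_gconnected[OF assms(2)]
    ccf_iso[OF feynman_subgraph[OF assms(1) order.refl] subgraph_verts_iso[OF assms(1)]]
  by (simp add: graph_monomial_def)

text \<open>Induction on the multiset, adding one connected graph at a time. This justifies the
  choice made in \<open>graph_of\<close>.\<close>

lemma ex_graph_monomial:
  "\<exists>G :: (nat, nat, 't) fgraph. feynman G \<and> cycle_free G \<and> graph_monomial G = M"
proof (induction M)
  case empty
  let ?G = "\<lparr>verts = {}, edges = {}, src = \<lambda>_. None, tgt = \<lambda>_. None, etype = \<lambda>_. undefined\<rparr>
    :: (nat, nat, 't) fgraph"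
  have "feynman ?G" "cycle_free ?G" "graph_monomial ?G = {#}"
    by (auto simp: feynman_def cycle_free_def is_cycle_def internal_edges_def graph_monomial_def
      components_def)
  then show ?case by blast
next
  case (add x M)
  then obtain G :: "(nat, nat, 't) fgraph" where G: "feynman G" "cycle_free G" "graph_monomial G = M"
    by blast
  obtain K :: "(nat, nat, 't) fgraph" where K: "feynman K" "cycle_free K" "gconnected K" "x = ccf K"
    unfolding ccf_def by (cases x) blast
  \<comment> \<open>\<open>K\<close> and \<open>G\<close> may use the same numbers as labels; the
    sum types keep them apart, and a numbered model then brings the result back to
    \<open>nat\<close>.\<close>
  let ?D = "disjoint_union K G"
  have D: "feynman ?D" using K(1) G(1) by (rule feynman_disjoint_union)
  obtain L :: "(nat, nat, 't) fgraph" where L: "fgraph_iso ?D L"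
    using nat_model[OF D] by blast
  have "graph_monomial L = add_mset x M"
    using graph_monomial_iso[OF D L] graph_monomial_disjoint_union[OF K(1) G(1)]
      graph_monomial_gconnected[OF K(1,3)] G(3) K(4) by simp
  then show ?case
    using feynman_iso[OF D L] cycle_free_iso[OF D L cycle_free_disjoint_union[OF K(1) G(1) K(2) G(2)]]
    by blast
qed

lemma graph_of:
  "feynman (graph_of M)" "cycle_free (graph_of M)" "graph_monomial (graph_of M) = M"
  using someI_ex[OF ex_graph_monomial[of M]] by (auto simp: graph_of_def)

text \<open>A graph and the representative chosen for its monomial differ only by an isomorphism, so
  isomorphism-invariant formulas may be evaluated on the graph itself.\<close>

lemma graph_of_graph_monomial_iso:
  assumes "feynman G" "cycle_free G"
  shows "fgraph_iso G (graph_of (graph_monomial G))"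
  using assms by (intro iso_of_graph_monomial_eq) (simp_all add: graph_of)

section \<open>Contraction\<close>

lemma block_eq:
  assumes "partition_on A \<pi>" "P \<in> \<pi>" "v \<in> P"
  shows "block \<pi> v = P"
  unfolding block_def using assms partition_onD2[OF assms(1)]
  by (intro the_equality) (auto simp: disjoint_def)

lemma block_in:
  assumes "partition_on A \<pi>" "v \<in> A"
  shows "block \<pi> v \<in> \<pi>" "v \<in> block \<pi> v"
proof -
  obtain P where "P \<in> \<pi>" "v \<in> P" using assms by (auto simp: partition_on_def)
  then show "block \<pi> v \<in> \<pi>" "v \<in> block \<pi> v" using block_eq[OF assms(1)] by auto
qed

lemma internal_edges_subgraph:
  "internal_edges (subgraph G P) =
     {e \<in> edges G. \<exists>v\<in>P. \<exists>w\<in>P. src G e = Some v \<and> tgt G e = Some w}"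
  by (auto simp: internal_edges_def)

lemma contract_simps [simp]:
  "verts (contract G \<pi>) = \<pi>"
  "edges (contract G \<pi>) = edges G - (\<Union>P\<in>\<pi>. internal_edges (subgraph G P))"
  "src (contract G \<pi>) e = map_option (block \<pi>) (src G e)"
  "tgt (contract G \<pi>) e = map_option (block \<pi>) (tgt G e)"
  "etype (contract G \<pi>) = etype G"
  by (simp_all add: contract_def)

text \<open>An edge with both ends in one block is internal to that block and is deleted, so the
  surviving arcs are exactly those induced by arcs between different blocks.\<close>

lemma arcs_contract:
  assumes G: "feynman G" and \<pi>: "partition_on (verts G) \<pi>"
  shows "(P, Q) \<in> arcs (contract G \<pi>) \<longleftrightarrow>
    P \<in> \<pi> \<and> Q \<in> \<pi> \<and> P \<noteq> Q \<and> (\<exists>v\<in>P. \<exists>w\<in>Q. (v, w) \<in> arcs G)"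
proof
  assume "(P, Q) \<in> arcs (contract G \<pi>)"
  then obtain e where e: "e \<in> edges (contract G \<pi>)" "src (contract G \<pi>) e = Some P"
    "tgt (contract G \<pi>) e = Some Q" by (rule arcsE)
  then obtain v w where vw: "src G e = Some v" "P = block \<pi> v" "tgt G e = Some w" "Q = block \<pi> w"
    by auto
  have eG: "e \<in> edges G" using e(1) by simp
  have V: "v \<in> verts G" "w \<in> verts G" using feynmanD(3,4)[OF G eG] vw by auto
  note bl = block_in[OF \<pi> V(1), folded vw(2)] block_in[OF \<pi> V(2), folded vw(4)]
  moreover have "P \<noteq> Q"
    using e(1) eG vw(1,3) bl by (auto simp: internal_edges_subgraph)
  ultimately show "P \<in> \<pi> \<and> Q \<in> \<pi> \<and> P \<noteq> Q \<and> (\<exists>v\<in>P. \<exists>w\<in>Q. (v, w) \<in> arcs G)"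
    using arcsI[OF eG vw(1,3)] by blast
next
  assume "P \<in> \<pi> \<and> Q \<in> \<pi> \<and> P \<noteq> Q \<and> (\<exists>v\<in>P. \<exists>w\<in>Q. (v, w) \<in> arcs G)"
  then obtain v w where PQ: "P \<in> \<pi>" "Q \<in> \<pi>" "P \<noteq> Q" "v \<in> P" "w \<in> Q" "(v, w) \<in> arcs G" by blast
  obtain e where e: "e \<in> edges G" "src G e = Some v" "tgt G e = Some w"
    using PQ(6) by (rule arcsE)
  have "block \<pi> v = P" "block \<pi> w = Q" using block_eq[OF \<pi>] PQ by auto
  moreover have "e \<in> edges (contract G \<pi>)"
  proof -
    have "\<not> (v \<in> B \<and> w \<in> B)" if "B \<in> \<pi>" for B
      using block_eq[OF \<pi> that] \<open>block \<pi> v = P\<close> \<open>block \<pi> w = Q\<close> PQ(3) by metis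
    then show ?thesis using e by (auto simp: internal_edges_subgraph)
  qed
  ultimately show "(P, Q) \<in> arcs (contract G \<pi>)" using e by (intro arcsI) auto
qed

lemma feynman_contract:
  assumes G: "feynman G" and \<pi>: "partition_on (verts G) \<pi>"
  shows "feynman (contract G \<pi>)"
proof -
  have "finite \<pi>" using finite_elements[OF feynmanD(1)[OF G] \<pi>] .
  then show ?thesis
    using feynmanD[OF G] block_in[OF \<pi>] unfolding feynman_def
    by (auto simp: option.set_map)
qed

section \<open>Transport of contractions along isomorphisms\<close>

lemma partition_on_image:
  assumes "inj_on f A" "partition_on A \<pi>"
  shows "partition_on (f ` A) ((\<lambda>P. f ` P) ` \<pi>)"
proof -
  have "{} \<notin> (\<lambda>P. f ` P) ` \<pi>" using partition_onD3[OF assms(2)] by auto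
  then show ?thesis using partition_on_inj_image[OF assms(2,1)] by simp
qed

lemma internal_edges_iso_via:
  assumes "iso_via f g G H"
  shows "internal_edges H = g ` internal_edges G"
proof -
  have "internal_edges H = g ` {e \<in> edges G. src H (g e) \<noteq> None \<and> tgt H (g e) \<noteq> None}"
    unfolding internal_edges_def iso_viaD(6)[OF assms, symmetric] by blast
  also have "{e \<in> edges G. src H (g e) \<noteq> None \<and> tgt H (g e) \<noteq> None} = internal_edges G"
    unfolding internal_edges_def by (rule Collect_cong) (simp add: iso_viaD(8,9)[OF assms] cong: conj_cong)
  finally show ?thesis .
qed

text \<open>Relabelling commutes with taking the block of a vertex and with taking the internal
  edges of a block. Injectivity on edges lets the image pass through the set difference that defines
  the contracted edges.\<close>

lemma contract_iso_via:
  assumes i: "iso_via f g G H" and G: "feynman G" and \<pi>: "partition_on (verts G) \<pi>"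
  shows "iso_via (\<lambda>P. f ` P) g (contract G \<pi>) (contract H ((\<lambda>P. f ` P) ` \<pi>))"
proof -
  note D = iso_viaD[OF i]
  let ?\<pi> = "(\<lambda>P. f ` P) ` \<pi>"
  have \<pi>': "partition_on (verts H) ?\<pi>" using partition_on_image[OF D(3) \<pi>] D(4) by simp
  have P: "P \<subseteq> verts G" if "P \<in> \<pi>" for P using that partition_onD1[OF \<pi>] by blast
  have bl: "block ?\<pi> (f v) = f ` block \<pi> v" if "v \<in> verts G" for v
    using block_in[OF \<pi> that] by (intro block_eq[OF \<pi>']) auto
  then have bl': "map_option (block ?\<pi>) (map_option f x) = map_option (\<lambda>P. f ` P) (map_option (block \<pi>) x)"
    if "set_option x \<subseteq> verts G" for x
    using that by (cases x) auto
  have int: "internal_edges (subgraph H (f ` P)) = g ` internal_edges (subgraph G P)" if "P \<in> \<pi>" for P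
    using internal_edges_iso_via[OF subgraph_iso_via[OF i G P[OF that]]] .
  have "edges (contract H ?\<pi>) = g ` edges G - g ` (\<Union>P\<in>\<pi>. internal_edges (subgraph G P))"
    using int D(6) by (simp add: image_UN)
  also have "\<dots> = g ` edges (contract G \<pi>)"
    unfolding contract_simps by (rule inj_on_image_set_diff[OF D(5), symmetric]) (auto simp: internal_edges_def)
  finally have "bij_betw g (edges (contract G \<pi>)) (edges (contract H ?\<pi>))"
    using inj_on_subset[OF D(5), of "edges (contract G \<pi>)"] by (auto simp: bij_betw_def)
  moreover have "inj_on (\<lambda>P. f ` P) \<pi>"
    using inj_on_image[of f \<pi>] D(3) partition_onD1[OF \<pi>] by simp
  moreover have "src (contract H ?\<pi>) (g e) = map_option (\<lambda>P. f ` P) (src (contract G \<pi>) e) \<and>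
    tgt (contract H ?\<pi>) (g e) = map_option (\<lambda>P. f ` P) (tgt (contract G \<pi>) e) \<and>
    etype (contract H ?\<pi>) (g e) = etype (contract G \<pi>) e" if "e \<in> edges (contract G \<pi>)" for e
  proof -
    have e: "e \<in> edges G" using that by simp
    then have "set_option (src G e) \<subseteq> verts G" "set_option (tgt G e) \<subseteq> verts G"
      using G by (auto simp: feynman_def)
    then show ?thesis using D(8-10)[OF e] bl' by simp
  qed
  ultimately show ?thesis by (auto simp: iso_via_def bij_betw_def simp del: contract_simps(2-5))
qed

lemma poset_compatible_iso_via:
  assumes i: "iso_via f g G H" and G: "feynman G" and \<pi>: "poset_compatible G \<pi>"
  shows "poset_compatible H ((\<lambda>P. f ` P) ` \<pi>)"
proof -
  note D = iso_viaD[OF i]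
  have p: "partition_on (verts G) \<pi>" and c: "\<And>P. P \<in> \<pi> \<Longrightarrow> gconnected (subgraph G P)"
    and cf: "cycle_free (contract G \<pi>)"
    using \<pi> by (auto simp: poset_compatible_def covering_def)
  have "gconnected (subgraph H (f ` P))" if "P \<in> \<pi>" for P
  proof -
    have P: "P \<subseteq> verts G" using that partition_onD1[OF p] by blast
    show ?thesis
      using gconnected_iso_via[OF subgraph_iso_via[OF i G P] feynman_subgraph[OF G P] c[OF that]] .
  qed
  moreover have "partition_on (verts H) ((\<lambda>P. f ` P) ` \<pi>)"
    using partition_on_image[OF D(3) p] D(4) by simp
  moreover have "cycle_free (contract H ((\<lambda>P. f ` P) ` \<pi>))"
    using cycle_free_iso_via[OF contract_iso_via[OF i G p] feynman_contract[OF G p] cf] .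
  ultimately show ?thesis by (auto simp: poset_compatible_def covering_def)
qed

section \<open>Invariance of the two coproduct formulas under isomorphism\<close>

lemma image_image_partition:
  assumes "\<And>v. v \<in> A \<Longrightarrow> f' (f v) = v" "partition_on A \<pi>"
  shows "(\<lambda>P. f' ` P) ` (\<lambda>P. f ` P) ` \<pi> = \<pi>"
proof -
  have "f' ` f ` P = P" if "P \<in> \<pi>" for P
  proof -
    have "f' ` f ` P = (\<lambda>v. f' (f v)) ` P" by (rule image_image)
    also have "\<dots> = (\<lambda>v. v) ` P"
      using assms(1) partition_onD1[OF assms(2)] that by (intro image_cong refl) blast
    finally show ?thesis by simp
  qed
  then have "(\<lambda>P. f' ` f ` P) ` \<pi> = (\<lambda>P. P) ` \<pi>" by (intro image_cong refl)
  then show ?thesis by (subst image_image) simp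
qed

text \<open>Taking images of blocks is a bijection between the compatible partitions of the two
  graphs, and corresponding blocks and contractions are isomorphic, hence have equal
  monomials.\<close>

lemma Delta_formula_iso:
  assumes G: "feynman G" and "fgraph_iso G H"
  shows "Delta_formula G = Delta_formula H"
proof -
  obtain f g where i: "iso_via f g G H" using assms fgraph_iso_iff by blast
  note D = iso_viaD[OF i]
  let ?f = "inv_into (verts G) f"
  have H: "feynman H" using feynman_iso_via[OF i G] .
  have i': "iso_via ?f (inv_into (edges G) g) H G" using iso_via_inverse[OF G i] .
  show ?thesis unfolding Delta_formula_def
  proof (rule sum.reindex_bij_witness[where j = "\<lambda>\<pi>. (\<lambda>P. f ` P) ` \<pi>" and i = "\<lambda>\<pi>. (\<lambda>P. ?f ` P) ` \<pi>"])
    fix \<pi> assume "\<pi> \<in> {\<pi>. poset_compatible G \<pi>}"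
    then have \<pi>: "poset_compatible G \<pi>" and p: "partition_on (verts G) \<pi>"
      by (auto simp: poset_compatible_def covering_def)
    show "(\<lambda>P. ?f ` P) ` (\<lambda>P. f ` P) ` \<pi> = \<pi>"
      using D(3) p by (intro image_image_partition) auto
    show "(\<lambda>P. f ` P) ` \<pi> \<in> {\<pi>. poset_compatible H \<pi>}"
      using poset_compatible_iso_via[OF i G \<pi>] by simp
    have inj: "inj_on (\<lambda>P. f ` P) \<pi>"
      using inj_on_image[of f \<pi>] D(3) partition_onD1[OF p] by simp
    have "graph_monomial (subgraph H (f ` P)) = graph_monomial (subgraph G P)" if "P \<in> \<pi>" for P
    proof -
      have P: "P \<subseteq> verts G" using that partition_onD1[OF p] by blast
      have "fgraph_iso (subgraph G P) (subgraph H (f ` P))"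
        using subgraph_iso_via[OF i G P] fgraph_iso_iff by blast
      then show ?thesis
        using graph_monomial_iso[OF feynman_subgraph[OF G P]] by metis
    qed
    moreover have "graph_monomial (contract G \<pi>) = graph_monomial (contract H ((\<lambda>P. f ` P) ` \<pi>))"
      using graph_monomial_iso[OF feynman_contract[OF G p]] contract_iso_via[OF i G p] fgraph_iso_iff
      by blast
    ultimately show "(\<Prod>P\<in>(\<lambda>P. f ` P) ` \<pi>. graph_elt (subgraph H P)) \<otimes>
        graph_elt (contract H ((\<lambda>P. f ` P) ` \<pi>))
      = (\<Prod>P\<in>\<pi>. graph_elt (subgraph G P)) \<otimes> graph_elt (contract G \<pi>)"
      by (simp add: prod.reindex[OF inj] graph_elt_def)
  next
    fix \<pi> assume "\<pi> \<in> {\<pi>. poset_compatible H \<pi>}"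
    then have \<pi>: "poset_compatible H \<pi>" and p: "partition_on (verts H) \<pi>"
      by (auto simp: poset_compatible_def covering_def)
    show "(\<lambda>P. f ` P) ` (\<lambda>P. ?f ` P) ` \<pi> = \<pi>"
      using D(4) p by (intro image_image_partition) (auto simp: f_inv_into_f)
    show "(\<lambda>P. ?f ` P) ` \<pi> \<in> {\<pi>. poset_compatible G \<pi>}"
      using poset_compatible_iso_via[OF i' H \<pi>] by simp
  qed
qed

text \<open>The description of cuts by forbidden arcs is used on both sides, since arcs are carried
  over directly by the isomorphism.\<close>

lemma admissible_cut_iso_via:
  assumes i: "iso_via f g G H" and G: "feynman G" "cycle_free G" and cut: "admissible_cut G V1 V2"
  shows "admissible_cut H (f ` V1) (f ` V2)"
proof -
  note D = iso_viaD[OF i]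
  have V: "V1 \<inter> V2 = {}" "V1 \<union> V2 = verts G" "V1 \<subseteq> verts G" "V2 \<subseteq> verts G"
    and no: "\<And>v w. (v, w) \<in> arcs G \<Longrightarrow> v \<in> V1 \<Longrightarrow> w \<notin> V2"
    using cut unfolding admissible_cut_iff[OF G] by auto
  have "f ` V1 \<inter> f ` V2 = {}"
    using inj_on_image_Int[OF D(3) V(3,4)] V(1) by simp
  moreover have "f ` V1 \<union> f ` V2 = verts H" using V(2) D(4) by (metis image_Un)
  moreover have no': "f w \<notin> f ` V2" if "(v, w) \<in> arcs G" "f v \<in> f ` V1" for v w
    using no[OF that(1)] that(2) arcs_in_verts[OF G(1) that(1)] inj_on_image_mem_iff[OF D(3)] V(3,4)
    by blast
  moreover have "y \<notin> f ` V2" if "(x, y) \<in> arcs H" "x \<in> f ` V1" for x y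
  proof -
    have "(x, y) \<in> map_prod f f ` arcs G" using that(1) unfolding arcs_iso_via[OF i] .
    then obtain v w where "(v, w) \<in> arcs G" "x = f v" "y = f w" by auto
    then show ?thesis using no' that(2) by simp
  qed
  ultimately show ?thesis
    unfolding admissible_cut_iff[OF feynman_iso_via[OF i G(1)] cycle_free_iso_via[OF i G]] by blast
qed

lemma Delta_c_formula_iso:
  assumes G: "feynman G" "cycle_free G" and "fgraph_iso G H"
  shows "Delta_c_formula G = Delta_c_formula H"
proof -
  obtain f g where i: "iso_via f g G H" using assms fgraph_iso_iff by blast
  note D = iso_viaD[OF i]
  let ?f = "inv_into (verts G) f"
  have H: "feynman H" "cycle_free H" using feynman_iso_via[OF i G(1)] cycle_free_iso_via[OF i G] .
  have i': "iso_via ?f (inv_into (edges G) g) H G" using iso_via_inverse[OF G(1) i] .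
  have canc: "?f ` f ` P = P" if "P \<subseteq> verts G" for P
    using that D(3) by (simp add: inv_into_image_cancel)
  have canc': "f ` ?f ` P = P" if "P \<subseteq> verts H" for P
    using that D(4) by (simp add: image_inv_into_cancel)
  have mono: "graph_monomial (subgraph H (f ` P)) = graph_monomial (subgraph G P)" if P: "P \<subseteq> verts G" for P
  proof -
    have "fgraph_iso (subgraph G P) (subgraph H (f ` P))"
      using subgraph_iso_via[OF i G(1) P] fgraph_iso_iff by blast
    then show ?thesis
      using graph_monomial_iso[OF feynman_subgraph[OF G(1) P]] by metis
  qed
  show ?thesis unfolding Delta_c_formula_def
  proof (rule sum.reindex_bij_witness[where j = "\<lambda>(V1, V2). (f ` V1, f ` V2)"
        and i = "\<lambda>(V1, V2). (?f ` V1, ?f ` V2)"])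
    fix V assume "V \<in> {(V1, V2). admissible_cut G V1 V2}"
    then obtain V1 V2 where V: "V = (V1, V2)" and cut: "admissible_cut G V1 V2" by auto
    have sub: "V1 \<subseteq> verts G" "V2 \<subseteq> verts G" using cut by (auto simp: admissible_cut_def)
    show "(case case V of (V1, V2) \<Rightarrow> (f ` V1, f ` V2) of (V1, V2) \<Rightarrow> (?f ` V1, ?f ` V2)) = V"
      using canc sub by (simp add: V)
    show "(case V of (V1, V2) \<Rightarrow> (f ` V1, f ` V2)) \<in> {(V1, V2). admissible_cut H V1 V2}"
      using admissible_cut_iso_via[OF i G cut] by (simp add: V)
    show "(case case V of (V1, V2) \<Rightarrow> (f ` V1, f ` V2) of
        (V1, V2) \<Rightarrow> graph_elt (subgraph H V1) \<otimes> graph_elt (subgraph H V2)) =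
      (case V of (V1, V2) \<Rightarrow> graph_elt (subgraph G V1) \<otimes> graph_elt (subgraph G V2))"
      using mono sub by (simp add: V graph_elt_def)
  next
    fix V assume "V \<in> {(V1, V2). admissible_cut H V1 V2}"
    then obtain V1 V2 where V: "V = (V1, V2)" and cut: "admissible_cut H V1 V2" by auto
    have sub: "V1 \<subseteq> verts H" "V2 \<subseteq> verts H" using cut by (auto simp: admissible_cut_def)
    show "(case case V of (V1, V2) \<Rightarrow> (?f ` V1, ?f ` V2) of (V1, V2) \<Rightarrow> (f ` V1, f ` V2)) = V"
      using canc' sub by (simp add: V)
    show "(case V of (V1, V2) \<Rightarrow> (?f ` V1, ?f ` V2)) \<in> {(V1, V2). admissible_cut G V1 V2}"
      using admissible_cut_iso_via[OF i' H cut] by (simp add: V)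
  qed
qed

section \<open>Cuts of a contraction\<close>

lemma partition_on_subset: "partition_on A \<pi> \<Longrightarrow> W \<subseteq> \<pi> \<Longrightarrow> partition_on (\<Union>W) W"
  unfolding partition_on_def disjoint_def by blast

lemma poset_compatibleD:
  assumes "poset_compatible G \<pi>"
  shows "partition_on (verts G) \<pi>" "P \<in> \<pi> \<Longrightarrow> gconnected (subgraph G P)" "cycle_free (contract G \<pi>)"
  using assms by (auto simp: poset_compatible_def covering_def)

text \<open>Restriction and contraction commute when the restriction is to a union of blocks. The
  isomorphism is the identity on blocks and on edges; the ends are only shown to agree on edges of
  \<open>G\<close>, where every end lies in some block.\<close>

lemma contract_subgraph_iso:
  assumes G: "feynman G" and \<pi>: "partition_on (verts G) \<pi>" and W: "W \<subseteq> \<pi>"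
  shows "fgraph_iso (contract (subgraph G (\<Union>W)) W) (subgraph (contract G \<pi>) W)"
proof -
  have W': "partition_on (\<Union>W) W"
    using \<pi> W by (rule partition_on_subset)
  have mem: "v \<in> \<Union>W \<longleftrightarrow> block \<pi> v \<in> W" if "v \<in> verts G" for v
    using block_eq[OF \<pi>] block_in[OF \<pi> that] W by blast
  have bl: "block W v = block \<pi> v" if "v \<in> \<Union>W" for v
    using that W block_eq[OF \<pi>] block_eq[OF W'] by blast
  have r: "restrict_end W (map_option (block \<pi>) x) = map_option (block W) (restrict_end (\<Union>W) x)"
    if "set_option x \<subseteq> verts G" for x
    using that mem bl by (cases x) auto
  have r': "restrict_end W (map_option (block \<pi>) (src G e)) = map_option (block W) (restrict_end (\<Union>W) (src G e))"
    "restrict_end W (map_option (block \<pi>) (tgt G e)) = map_option (block W) (restrict_end (\<Union>W) (tgt G e))"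
    if "e \<in> edges G" for e
    using r that G by (auto simp: feynman_def)
  \<comment> \<open>\<open>T e\<close> says that \<open>e\<close> touches the union of the blocks in
    \<open>W\<close>, the survival condition for restriction on both sides.\<close>
  define T where "T e \<longleftrightarrow> restrict_end (\<Union>W) (src G e) \<noteq> None \<or> restrict_end (\<Union>W) (tgt G e) \<noteq> None" for e
  have touch: "restrict_end W (map_option (block \<pi>) (src G e)) \<noteq> None \<or>
      restrict_end W (map_option (block \<pi>) (tgt G e)) \<noteq> None \<longleftrightarrow> T e" if "e \<in> edges G" for e
    by (simp only: r'[OF that] option.map_disc_iff T_def)
  have sub: "internal_edges (subgraph (subgraph G (\<Union>W)) P) = internal_edges (subgraph G P)" if "P \<in> W" for P
    using that by (subst subgraph_subgraph) auto
  \<comment> \<open>An edge touching \<open>\<Union>W\<close> that is internal to a block of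
    \<open>\<pi>\<close> lies in a block of \<open>W\<close>. Hence, among these edges, deleting
    internal edges for \<open>\<pi>\<close> or for \<open>W\<close> has the same effect.\<close>
  have other: "P \<in> W" if "P \<in> \<pi>" "e \<in> internal_edges (subgraph G P)" and t: "T e" for P e
  proof -
    obtain v w where vw: "v \<in> P" "w \<in> P" "src G e = Some v" "tgt G e = Some w"
      using \<open>e \<in> internal_edges (subgraph G P)\<close> by (auto simp: internal_edges_subgraph)
    then obtain u where "u \<in> P" "u \<in> \<Union>W" using t by (auto simp: T_def split: if_splits)
    then show ?thesis using block_eq[OF \<pi> that(1)] mem[of u] that(1) partition_onD1[OF \<pi>] by blast
  qed
  have "edges (contract (subgraph G (\<Union>W)) W) = edges (subgraph (contract G \<pi>) W)"
  proof (rule set_eqI)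
    fix e
    have "e \<in> edges (contract (subgraph G (\<Union>W)) W) \<longleftrightarrow>
        (e \<in> edges G \<and> T e) \<and> (\<forall>P\<in>W. e \<notin> internal_edges (subgraph G P))"
      unfolding contract_simps subgraph_simps T_def[symmetric] using sub by auto
    also have "\<dots> \<longleftrightarrow> (e \<in> edges G \<and> (\<forall>P\<in>\<pi>. e \<notin> internal_edges (subgraph G P))) \<and> T e"
      using other W by blast
    also have "\<dots> \<longleftrightarrow> e \<in> edges (subgraph (contract G \<pi>) W)"
      unfolding contract_simps subgraph_simps mem_Collect_eq Diff_iff UN_iff
      by (cases "e \<in> edges G") (simp_all only: touch simp_thms bex_simps ball_simps)
    finally show "e \<in> edges (contract (subgraph G (\<Union>W)) W) \<longleftrightarrow> e \<in> edges (subgraph (contract G \<pi>) W)" .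
  qed
  then show ?thesis
    unfolding fgraph_iso_def
    by (intro exI[of _ id]) (auto simp: r' option.map_id simp del: restrict_end_eq_Some)
qed

text \<open>An arc of \<open>G\<close> from \<open>\<Union>W1\<close> to \<open>\<Union>W2\<close>
  would induce an arc of the contraction violating the cut. Each restricted partition stays
  compatible because its contraction is isomorphic to a subgraph of the cycle-free graph
  \<open>contract G \<pi>\<close>.\<close>

lemma split_poset_compatible:
  assumes G: "feynman G" "cycle_free G" and \<pi>: "poset_compatible G \<pi>"
    and cut: "admissible_cut (contract G \<pi>) W1 W2"
  shows "\<pi> = W1 \<union> W2" "admissible_cut G (\<Union>W1) (\<Union>W2)"
    "poset_compatible (subgraph G (\<Union>W1)) W1" "poset_compatible (subgraph G (\<Union>W2)) W2"
proof -
  note p = poset_compatibleD[OF \<pi>]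
  have W: "W1 \<inter> W2 = {}" "W1 \<union> W2 = \<pi>" and no: "\<And>P Q. (P, Q) \<in> arcs (contract G \<pi>) \<Longrightarrow> P \<in> W1 \<Longrightarrow> Q \<notin> W2"
    using cut unfolding admissible_cut_iff[OF feynman_contract[OF G(1) p(1)] p(3)] by auto
  show "\<pi> = W1 \<union> W2" using W(2) by simp
  have disj: "P = Q" if "P \<in> \<pi>" "Q \<in> \<pi>" "v \<in> P" "v \<in> Q" for P Q v
    using block_eq[OF p(1)] that by metis
  have "\<Union>W1 \<inter> \<Union>W2 = {}" using disj W by blast
  moreover have "\<Union>W1 \<union> \<Union>W2 = verts G" using W(2) partition_onD1[OF p(1)] by blast
  moreover have "w \<notin> \<Union>W2" if vw: "(v, w) \<in> arcs G" "v \<in> \<Union>W1" for v w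
  proof
    assume "w \<in> \<Union>W2"
    then obtain P Q where PQ: "v \<in> P" "P \<in> W1" "w \<in> Q" "Q \<in> W2" using vw(2) by blast
    then have "(P, Q) \<in> arcs (contract G \<pi>)"
      unfolding arcs_contract[OF G(1) p(1)] using vw(1) W by blast
    then show False using no PQ by blast
  qed
  ultimately show "admissible_cut G (\<Union>W1) (\<Union>W2)"
    unfolding admissible_cut_iff[OF G] by blast
  have pc: "poset_compatible (subgraph G (\<Union>W)) W" if "W \<subseteq> \<pi>" for W
  proof -
    have "partition_on (\<Union>W) W"
      using p(1) that by (rule partition_on_subset)
    moreover have "gconnected (subgraph (subgraph G (\<Union>W)) P)" if "P \<in> W" for P
      using p(2) that \<open>W \<subseteq> \<pi>\<close> by (subst subgraph_subgraph) auto
    moreover have sub: "\<Union>W \<subseteq> verts G" using that partition_onD1[OF p(1)] by blast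
    have "cycle_free (contract (subgraph G (\<Union>W)) W)"
    proof (rule cycle_free_iso)
      show "feynman (subgraph (contract G \<pi>) W)"
        using feynman_contract[OF G(1) p(1)] that by (intro feynman_subgraph) auto
      show "fgraph_iso (subgraph (contract G \<pi>) W) (contract (subgraph G (\<Union>W)) W)"
      proof (rule fgraph_iso_sym)
        show "feynman (contract (subgraph G (\<Union>W)) W)"
          using \<open>partition_on (\<Union>W) W\<close> feynman_subgraph[OF G(1) sub] by (simp add: feynman_contract)
      qed (rule contract_subgraph_iso[OF G(1) p(1) that])
      show "cycle_free (subgraph (contract G \<pi>) W)"
        using p(3) by (rule cycle_free_subgraph)
    qed
    ultimately show ?thesis by (auto simp: poset_compatible_def covering_def)
  qed
  show "poset_compatible (subgraph G (\<Union>W1)) W1" "poset_compatible (subgraph G (\<Union>W2)) W2"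
    using pc W by blast+
qed

text \<open>An arc of the contraction from \<open>\<pi>1\<close> to \<open>\<pi>2\<close> would come
  from an arc of \<open>G\<close> from \<open>V1\<close> to \<open>V2\<close>. Hence a cycle would
  stay inside one of the two families, whose induced graphs are isomorphic to the given cycle-free
  contractions.\<close>

lemma join_poset_compatible:
  assumes G: "feynman G" "cycle_free G" and cut: "admissible_cut G V1 V2"
    and \<pi>1: "poset_compatible (subgraph G V1) \<pi>1" and \<pi>2: "poset_compatible (subgraph G V2) \<pi>2"
  shows "poset_compatible G (\<pi>1 \<union> \<pi>2)" "admissible_cut (contract G (\<pi>1 \<union> \<pi>2)) \<pi>1 \<pi>2"
    "V1 = \<Union>\<pi>1" "V2 = \<Union>\<pi>2"
proof -
  note p1 = poset_compatibleD[OF \<pi>1, unfolded subgraph_simps]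
    and p2 = poset_compatibleD[OF \<pi>2, unfolded subgraph_simps]
  have V: "V1 \<inter> V2 = {}" "V1 \<union> V2 = verts G" and no: "\<And>v w. (v, w) \<in> arcs G \<Longrightarrow> v \<in> V1 \<Longrightarrow> w \<notin> V2"
    using cut unfolding admissible_cut_iff[OF G] by auto
  show U1: "V1 = \<Union>\<pi>1" and U2: "V2 = \<Union>\<pi>2" using p1(1) p2(1) by (auto simp: partition_on_def)
  let ?\<pi> = "\<pi>1 \<union> \<pi>2"
  have p: "partition_on (verts G) ?\<pi>"
    using p1(1) p2(1) V disjoint_union[of \<pi>1 \<pi>2] unfolding partition_on_def by simp
  \<comment> \<open>Disjointness of \<open>V1\<close> and \<open>V2\<close> passes to the families
    of blocks only because blocks are nonempty.\<close>
  have disj: "\<pi>1 \<inter> \<pi>2 = {}"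
  proof (rule equals0I)
    fix P assume P: "P \<in> \<pi>1 \<inter> \<pi>2"
    then have "P \<noteq> {}" using partition_onD3[OF p1(1)] by auto
    then show False using P V(1) unfolding U1 U2 by blast
  qed
  have con: "gconnected (subgraph G P)" if "P \<in> ?\<pi>" for P
    using that
  proof
    assume "P \<in> \<pi>1"
    moreover have "P \<subseteq> V1" using \<open>P \<in> \<pi>1\<close> U1 by blast
    ultimately show ?thesis using p1(2)[of P] by (simp add: subgraph_subgraph)
  next
    assume "P \<in> \<pi>2"
    moreover have "P \<subseteq> V2" using \<open>P \<in> \<pi>2\<close> U2 by blast
    ultimately show ?thesis using p2(2)[of P] by (simp add: subgraph_subgraph)
  qed
  have no': "Q \<notin> \<pi>2" if "(P, Q) \<in> arcs (contract G ?\<pi>)" "P \<in> \<pi>1" for P Q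
    using that no unfolding arcs_contract[OF G(1) p] U1 U2 by blast
  have fc: "feynman (contract G ?\<pi>)" using feynman_contract[OF G(1) p] .
  have iso1: "fgraph_iso (contract (subgraph G V1) \<pi>1) (subgraph (contract G ?\<pi>) \<pi>1)"
    and iso2: "fgraph_iso (contract (subgraph G V2) \<pi>2) (subgraph (contract G ?\<pi>) \<pi>2)"
    unfolding U1 U2 by (rule contract_subgraph_iso[OF G(1) p], simp)+
  have f1: "feynman (contract (subgraph G V1) \<pi>1)"
    using p1(1) feynman_subgraph[OF G(1)] V(2) by (intro feynman_contract) auto
  have f2: "feynman (contract (subgraph G V2) \<pi>2)"
    using p2(1) feynman_subgraph[OF G(1)] V(2) by (intro feynman_contract) auto
  have cf: "cycle_free (contract G ?\<pi>)"
    unfolding cycle_free_iff_acyclic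
  proof (rule acyclic_two_parts[of _ \<pi>1 \<pi>2])
    show "arcs (contract G ?\<pi>) \<subseteq> ?\<pi> \<times> ?\<pi>" using arcs_in_verts[OF fc] by auto
    show "(P, Q) \<in> arcs (contract G ?\<pi>) \<Longrightarrow> P \<in> \<pi>1 \<Longrightarrow> Q \<in> \<pi>2 \<Longrightarrow> False" for P Q using no' by blast
    show "acyclic (arcs (contract G ?\<pi>) \<inter> \<pi>1 \<times> \<pi>1)" "acyclic (arcs (contract G ?\<pi>) \<inter> \<pi>2 \<times> \<pi>2)"
      using cycle_free_iso[OF f1 iso1 p1(3)] cycle_free_iso[OF f2 iso2 p2(3)]
      by (simp_all add: cycle_free_iff_acyclic arcs_subgraph)
  qed
  show "poset_compatible G ?\<pi>" using p con cf by (simp add: poset_compatible_def covering_def)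
  show "admissible_cut (contract G ?\<pi>) \<pi>1 \<pi>2"
    unfolding admissible_cut_iff[OF fc cf] using disj no' by simp
qed

lemma finite_poset_compatible: "feynman G \<Longrightarrow> finite {\<pi>. poset_compatible G \<pi>}"
  using finitely_many_partition_on[OF feynmanD(1)]
  by (rule rev_finite_subset) (auto dest: poset_compatibleD)

lemma finite_admissible_cut: "feynman G \<Longrightarrow> finite {(V1, V2). admissible_cut G V1 V2}"
  by (rule finite_subset[of _ "Pow (verts G) \<times> Pow (verts G)"])
    (auto simp: admissible_cut_def feynmanD(1))

section \<open>The comodule coalgebra identity\<close>

text \<open>This is the exponent of the product \<open>\<gamma>\<close> in the first tensor factor;
  with it both formulas become sums of basis elements.\<close>

definition part_monomial :: "('v, 'e, 't) fgraph \<Rightarrow> 'v set set \<Rightarrow> 't ccf_graph multiset" where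
  "part_monomial G \<pi> = (\<Sum>P\<in>\<pi>. graph_monomial (subgraph G P))"

lemma Delta_formula_basis:
  "Delta_formula G = (\<Sum>\<pi> | poset_compatible G \<pi>. basis (part_monomial G \<pi>, graph_monomial (contract G \<pi>)))"
  by (simp add: Delta_formula_def graph_elt_def prod_basis tensor_basis part_monomial_def)

lemma Delta_c_formula_basis:
  "Delta_c_formula G = (\<Sum>(V1, V2)\<in>{(V1, V2). admissible_cut G V1 V2}.
     basis (graph_monomial (subgraph G V1), graph_monomial (subgraph G V2)))"
  by (simp add: Delta_c_formula_def graph_elt_def tensor_basis)

text \<open>Isomorphism invariance removes the dependence on the representative chosen by
  \<open>graph_of\<close>.\<close>

lemma Phi_graph:
  assumes "feynman G" "cycle_free G"
  shows "Phi (basis (graph_monomial G)) = Delta_formula G"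
  unfolding Phi_def Delta_def lin_ext_basis
  using Delta_formula_iso[OF assms(1) graph_of_graph_monomial_iso[OF assms]] by (rule sym)

lemma Delta_c_graph:
  assumes "feynman G" "cycle_free G"
  shows "Delta_c (basis (graph_monomial G)) = Delta_c_formula G"
  unfolding Delta_c_def lin_ext_basis
  using Delta_c_formula_iso[OF assms graph_of_graph_monomial_iso[OF assms]] by (rule sym)

text \<open>Compatibility makes each contraction cycle-free, so its coproduct \<open>Delta_c\<close>
  is given by the formula on the contraction itself. Finiteness of the index sets allows the nested
  sums to be merged.\<close>

lemma tensor_map_id_Delta_c_Delta_formula:
  assumes G: "feynman G"
  shows "tensor_map id Delta_c (Delta_formula G) =
    (\<Sum>(\<pi>, W1, W2)\<in>(SIGMA \<pi>:{\<pi>. poset_compatible G \<pi>}. {(W1, W2). admissible_cut (contract G \<pi>) W1 W2}).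
      basis (part_monomial G \<pi>, graph_monomial (subgraph (contract G \<pi>) W1),
        graph_monomial (subgraph (contract G \<pi>) W2)))"
proof -
  have "tensor_map id Delta_c (basis (part_monomial G \<pi>, graph_monomial (contract G \<pi>)))
     = (\<Sum>(W1, W2)\<in>{(W1, W2). admissible_cut (contract G \<pi>) W1 W2}.
      basis (part_monomial G \<pi>, graph_monomial (subgraph (contract G \<pi>) W1),
        graph_monomial (subgraph (contract G \<pi>) W2)))"
    if "poset_compatible G \<pi>" for \<pi>
    using feynman_contract[OF G] poset_compatibleD[OF that]
    by (simp add: tensor_map_def Delta_c_graph Delta_c_formula_basis tensor_sum_right tensor_basis
        case_prod_unfold)
  then have "tensor_map id Delta_c (Delta_formula G) =
    (\<Sum>\<pi> | poset_compatible G \<pi>. \<Sum>(W1, W2)\<in>{(W1, W2). admissible_cut (contract G \<pi>) W1 W2}.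
      basis (part_monomial G \<pi>, graph_monomial (subgraph (contract G \<pi>) W1),
        graph_monomial (subgraph (contract G \<pi>) W2)))"
    unfolding Delta_formula_basis tensor_map_def lin_ext_sum by (intro sum.cong refl) simp
  also have "\<dots> = (\<Sum>(\<pi>, W1, W2)\<in>(SIGMA \<pi>:{\<pi>. poset_compatible G \<pi>}. {(W1, W2). admissible_cut (contract G \<pi>) W1 W2}).
      basis (part_monomial G \<pi>, graph_monomial (subgraph (contract G \<pi>) W1),
        graph_monomial (subgraph (contract G \<pi>) W2)))"
    using finite_poset_compatible[OF G] finite_admissible_cut feynman_contract[OF G] poset_compatibleD(1)
    by (intro sum.Sigma) blast+
  finally show ?thesis .
qed

lemma m13_basis: "m13 (basis ((a, b), (c, d))) = basis (a + c, b, d)"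
  by (simp add: m13_def mult_single tensor_basis)

lemma m13_sum: "m13 (sum f A) = (\<Sum>i\<in>A. m13 (f i))"
  by (simp add: m13_def lin_ext_sum)

text \<open>Both restrictions along a cut are cycle-free, so \<open>Phi\<close> is given by its
  formula on each. Expanding the tensor product pairs the partitions, and \<open>m13\<close> adds
  the exponents of the two first factors.\<close>

lemma m13_tensor_map_Phi_Delta_c_formula:
  fixes G :: "('v, 'e, 't) fgraph"
  assumes G: "feynman G" "cycle_free G"
  shows "m13 (tensor_map Phi Phi (Delta_c_formula G)) =
    (\<Sum>((V1, V2), \<pi>1, \<pi>2)\<in>(SIGMA (V1, V2):{(V1, V2). admissible_cut G V1 V2}.
        {\<pi>. poset_compatible (subgraph G V1) \<pi>} \<times> {\<pi>. poset_compatible (subgraph G V2) \<pi>}).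
      basis (part_monomial (subgraph G V1) \<pi>1 + part_monomial (subgraph G V2) \<pi>2,
        graph_monomial (contract (subgraph G V1) \<pi>1), graph_monomial (contract (subgraph G V2) \<pi>2)))"
  (is "_ = (\<Sum>((V1, V2), \<pi>1, \<pi>2)\<in>_. ?f V1 V2 \<pi>1 \<pi>2)")
proof -
  have cut: "m13 (tensor_map Phi Phi (basis (graph_monomial (subgraph G V1), graph_monomial (subgraph G V2)))) =
      (\<Sum>(\<pi>1, \<pi>2)\<in>{\<pi>. poset_compatible (subgraph G V1) \<pi>} \<times> {\<pi>. poset_compatible (subgraph G V2) \<pi>}.
        ?f V1 V2 \<pi>1 \<pi>2)"
    if "admissible_cut G V1 V2" for V1 V2
  proof -
    have V: "V1 \<subseteq> verts G" "V2 \<subseteq> verts G" using that by (auto simp: admissible_cut_def)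
    have eq1: "tensor_map Phi Phi (basis (graph_monomial (subgraph G V1), graph_monomial (subgraph G V2))) =
      Delta_formula (subgraph G V1) \<otimes> Delta_formula (subgraph G V2)"
      using feynman_subgraph[OF G(1) V(1)] feynman_subgraph[OF G(1) V(2)] cycle_free_subgraph[OF G(2)]
      by (simp add: tensor_map_def Phi_graph)
    have eq2: "Delta_formula (subgraph G V1) \<otimes> Delta_formula (subgraph G V2) =
      (\<Sum>(\<pi>1, \<pi>2)\<in>{\<pi>. poset_compatible (subgraph G V1) \<pi>} \<times> {\<pi>. poset_compatible (subgraph G V2) \<pi>}.
        basis ((part_monomial (subgraph G V1) \<pi>1, graph_monomial (contract (subgraph G V1) \<pi>1)),
          (part_monomial (subgraph G V2) \<pi>2, graph_monomial (contract (subgraph G V2) \<pi>2))))"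
      by (simp only: Delta_formula_basis tensor_sum_left)
        (simp only: tensor_sum_right tensor_basis sum.cartesian_product)
    show ?thesis by (simp only: eq1 eq2 m13_sum case_prod_unfold m13_basis)
  qed
  have "m13 (tensor_map Phi Phi (Delta_c_formula G)) =
    (\<Sum>(V1, V2)\<in>{(V1, V2). admissible_cut G V1 V2}.
       m13 (tensor_map Phi Phi (basis (graph_monomial (subgraph G V1), graph_monomial (subgraph G V2)))))"
    unfolding Delta_c_formula_basis tensor_map_def m13_def lin_ext_sum case_prod_unfold ..
  also have "\<dots> = (\<Sum>(V1, V2)\<in>{(V1, V2). admissible_cut G V1 V2}.
      \<Sum>(\<pi>1, \<pi>2)\<in>{\<pi>. poset_compatible (subgraph G V1) \<pi>} \<times> {\<pi>. poset_compatible (subgraph G V2) \<pi>}.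
        ?f V1 V2 \<pi>1 \<pi>2)"
    using cut by (intro sum.cong refl) auto
  also have "\<dots> = (\<Sum>((V1, V2), \<pi>1, \<pi>2)\<in>(SIGMA (V1, V2):{(V1, V2). admissible_cut G V1 V2}.
        {\<pi>. poset_compatible (subgraph G V1) \<pi>} \<times> {\<pi>. poset_compatible (subgraph G V2) \<pi>}). ?f V1 V2 \<pi>1 \<pi>2)"
  proof -
    have "finite ({\<pi>. poset_compatible (subgraph G V1) \<pi>} \<times> {\<pi>. poset_compatible (subgraph G V2) \<pi>})"
      if "admissible_cut G V1 V2" for V1 V2
      using that feynman_subgraph[OF G(1)] unfolding admissible_cut_def
      by (intro finite_cartesian_product finite_poset_compatible) auto
    then show ?thesis
      using finite_admissible_cut[OF G(1)]
      unfolding case_prod_unfold by (subst sum.Sigma) (auto simp: case_prod_unfold)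
  qed
  finally show ?thesis .
qed

lemma coaction_graph:
  assumes G: "feynman G" "cycle_free G"
  shows "tensor_map id Delta_c (Delta_formula G) = m13 (tensor_map Phi Phi (Delta_c_formula G))"
  unfolding tensor_map_id_Delta_c_Delta_formula[OF G(1)] m13_tensor_map_Phi_Delta_c_formula[OF G]
proof (rule sum.reindex_bij_witness[where j = "\<lambda>(\<pi>, W1, W2). ((\<Union>W1, \<Union>W2), W1, W2)"
      and i = "\<lambda>((V1, V2), \<pi>1, \<pi>2). (\<pi>1 \<union> \<pi>2, \<pi>1, \<pi>2)"], goal_cases)
  \<comment> \<open>Cases 1 and 2 use the splitting of a partition along a cut, cases 3 and 4 the
    joining of two partitions; the last case compares the terms.\<close>
  case (1 a)
  then show ?case using split_poset_compatible(1)[OF G] by auto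
next
  case (2 a)
  then show ?case using split_poset_compatible(2-4)[OF G] by auto
next
  case (3 b)
  then obtain V1 V2 \<pi>1 \<pi>2 where b: "b = ((V1, V2), \<pi>1, \<pi>2)" and "admissible_cut G V1 V2"
    "poset_compatible (subgraph G V1) \<pi>1" "poset_compatible (subgraph G V2) \<pi>2" by auto
  note j = join_poset_compatible[OF G this(2-4)]
  show ?case unfolding b using j(3,4) by auto
next
  case (4 b)
  then obtain V1 V2 \<pi>1 \<pi>2 where b: "b = ((V1, V2), \<pi>1, \<pi>2)" and "admissible_cut G V1 V2"
    "poset_compatible (subgraph G V1) \<pi>1" "poset_compatible (subgraph G V2) \<pi>2" by auto
  note j = join_poset_compatible[OF G this(2-4)]
  show ?case unfolding b using j(1,2) by auto
next
  case (5 a)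
  then obtain \<pi> W1 W2 where a: "a = (\<pi>, W1, W2)" and \<pi>: "poset_compatible G \<pi>"
    and cut: "admissible_cut (contract G \<pi>) W1 W2" by auto
  note p = poset_compatibleD[OF \<pi>] and s = split_poset_compatible[OF G \<pi> cut]
  have W: "W1 \<inter> W2 = {}" "W1 \<subseteq> \<pi>" "W2 \<subseteq> \<pi>" using cut by (auto simp: admissible_cut_def)
  have fin: "finite W1" "finite W2"
    using finite_elements[OF feynmanD(1)[OF G(1)] p(1)] W finite_subset by blast+
  \<comment> \<open>The blocks in \<open>W\<close> lie inside \<open>\<Union>W\<close>, so passing
    to this subgraph first does not change the graphs on them. The first tensor factor is then a sum
    split over the disjoint families \<open>W1\<close> and \<open>W2\<close>.\<close>
  have part: "part_monomial (subgraph G (\<Union>W)) W = part_monomial G W" for W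
    unfolding part_monomial_def by (intro sum.cong refl) (subst subgraph_subgraph, auto)
  have "part_monomial G \<pi> = part_monomial (subgraph G (\<Union>W1)) W1 + part_monomial (subgraph G (\<Union>W2)) W2"
    unfolding part s(1) unfolding part_monomial_def using fin W(1) by (rule sum.union_disjoint)
  \<comment> \<open>The remaining two tensor factors agree because restriction to a union of blocks
    commutes with contraction.\<close>
  moreover have "graph_monomial (contract (subgraph G (\<Union>W)) W) = graph_monomial (subgraph (contract G \<pi>) W)"
    if "W \<subseteq> \<pi>" "poset_compatible (subgraph G (\<Union>W)) W" for W
  proof (rule graph_monomial_iso)
    have "\<Union>W \<subseteq> verts G" using that(1) partition_onD1[OF p(1)] by blast
    then show "feynman (contract (subgraph G (\<Union>W)) W)"
      using feynman_subgraph[OF G(1)] poset_compatibleD(1)[OF that(2)] by (intro feynman_contract) auto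
  qed (rule contract_subgraph_iso[OF G(1) p(1) that(1)])
  ultimately show ?case using s(3,4) W(2,3) by (simp add: a)
qed

theorem theorem4p1:
  shows "tensor_map id Delta_c \<circ> (Phi :: ('t, 'k::field) H \<Rightarrow> ('t, 'k) HH) =
    m13 \<circ> tensor_map Phi Phi \<circ> Delta_c"
proof
  fix x :: "('t, 'k) H"
  \<comment> \<open>Both sides are linear extensions, so it suffices to compare them on monomials
    \<open>M\<close>, each represented by the cycle-free graph \<open>graph_of M\<close>.\<close>
  have "(tensor_map id Delta_c \<circ> Phi) x =
      lin_ext (\<lambda>M. tensor_map id Delta_c (Delta_formula (graph_of M))) x"
    unfolding comp_def Phi_def Delta_def tensor_map_def by (rule lin_ext_lin_ext)
  also have "\<dots> = lin_ext (\<lambda>M. m13 (tensor_map Phi Phi (Delta_c_formula (graph_of M)))) x"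
    by (simp only: coaction_graph[OF graph_of(1,2)])
  also have "\<dots> = (m13 \<circ> tensor_map Phi Phi \<circ> Delta_c) x"
    unfolding comp_def m13_def tensor_map_def Delta_c_def by (simp add: lin_ext_lin_ext)
  finally show "(tensor_map id Delta_c \<circ> Phi) x = (m13 \<circ> tensor_map Phi Phi \<circ> Delta_c) x" .
qed

end
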